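(* Let $G$ be a finite simple graph without isolated vertices, with vertex set $V(G)$ and edge set $E(G)$. For each vertex $v$ let $d_v$ be the degree of $v$ in $G$, and let $i(G)$ denote the number of independent sets of $G$. Then \[ i(G) \le \prod_{uv \in E(G)} i(K_{d_u,d_v})^{1/(d_u d_v)} = \prod_{uv \in E(G)} \left(2^{d_u} + 2^{d_v} - 1\right)^{1/(d_u d_v)}. \] Equality in the inequality holds if and only if $G$ is a disjoint union of complete bipartite graphs.
   Context: All graphs are finite and simple (undirected). An isolated vertex is a vertex of degree $0$. The empty set counts as an independent set. $K_{a,b}$ denotes the complete bipartite graph with parts of sizes $a,b\ge 1$. In a disjoint union of complete bipartite graphs, the components may be $K_{a,b}$ with different values of $a,b\ge 1$. The product is over all (unordered) edges $uv$ of $G$. *)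

theory Defs
  imports
    Complex_Main
    "HOL-Library.Disjoint_Sets"
    "HOL-Library.Ramsey"
    "Graph_Theory.Kuratowski"
begin

text \<open>
  A finite simple graph is a \<^locale>\<open>pair_graph\<close>: a finite vertex set with a symmetric,
  irreflexive adjacency relation \<^const>\<open>parcs\<close>. So an undirected edge \<open>uv\<close> is the pair of
  opposite arcs \<open>(u, v)\<close>, \<open>(v, u)\<close>, and the degree of a vertex is its out-degree.
\<close>

abbreviation vdegree :: "'a pair_pre_digraph \<Rightarrow> 'a \<Rightarrow> nat" where
  "vdegree G v \<equiv> out_degree (with_proj G) v"

definition edges :: "'a pair_pre_digraph \<Rightarrow> 'a set set" where
  "edges G = {{u, v} |u v. (u, v) \<in> parcs G}"

definition num_indep :: "'a pair_pre_digraph \<Rightarrow> nat" where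
  "num_indep G = card {S. S \<subseteq> pverts G \<and> indep S (edges G)}"

text \<open>
  The product of \<open>f u v\<close> over the unordered edges \<open>uv\<close>. It is meaningful only for \<open>f\<close> symmetric
  on adjacent vertices; the description operator then returns the common value
  \<open>f u v = f v u\<close> (lemma \<open>edge_value\<close>).
\<close>

definition edge_prod :: "'a pair_pre_digraph \<Rightarrow> ('a \<Rightarrow> 'a \<Rightarrow> real) \<Rightarrow> real" where
  "edge_prod G f = (\<Prod>e\<in>edges G. THE x. \<exists>u v. e = {u, v} \<and> x = f u v)"

lemma edge_value:
  assumes "f u v = f v u"
  shows "(THE x. \<exists>u' v'. {u, v} = {u', v'} \<and> x = f u' v') = f u v"
  using assms by (intro the_equality) (auto simp: doubleton_eq_iff)

text \<open>
  The library's \<^const>\<open>complete_bipartite_digraph\<close> is a predicate on graphs; this is a concrete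
  representative of \<open>K\<^bsub>a,b\<^esub>\<close>.
\<close>

definition complete_bipartite :: "nat \<Rightarrow> nat \<Rightarrow> (nat + nat) pair_pre_digraph" where
  "complete_bipartite a b =
    \<lparr> pverts = Inl ` {..<a} \<union> Inr ` {..<b},
      parcs = Inl ` {..<a} \<times> Inr ` {..<b} \<union> Inr ` {..<b} \<times> Inl ` {..<a} \<rparr>"

lemma complete_bipartite_digraph_complete_bipartite:
  "complete_bipartite_digraph a b (with_proj (complete_bipartite a b))"
  unfolding complete_bipartite_digraph_pair_def
proof (intro conjI exI)
  show "finite (pverts (complete_bipartite a b))"
    by (simp add: complete_bipartite_def)
  show "pverts (complete_bipartite a b) = Inl ` {..<a} \<union> Inr ` {..<b}"
    and "parcs (complete_bipartite a b) =
      Inl ` {..<a} \<times> Inr ` {..<b} \<union> Inr ` {..<b} \<times> Inl ` {..<a}"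
    by (simp_all add: complete_bipartite_def)
qed (auto simp: card_image)

lemma num_indep_complete_bipartite_commute:
  "num_indep (complete_bipartite a b) = num_indep (complete_bipartite b a)"
proof -
  define sw :: "nat + nat \<Rightarrow> nat + nat" where "sw = case_sum Inr Inl"
  define I where "I a b = {S. S \<subseteq> pverts (complete_bipartite a b) \<and>
    indep S (edges (complete_bipartite a b))}" for a b
  have sw_simps [simp]: "sw (Inl i) = Inr i" "sw (Inr i) = Inl i" for i
    by (simp_all add: sw_def)
  have sw_sw [simp]: "sw (sw x) = x" for x
    by (cases x) simp_all
  have edge_iff: "{u, v} \<in> edges (complete_bipartite a b) \<longleftrightarrow>
      (u, v) \<in> parcs (complete_bipartite a b)" for u v a b
    by (auto simp: edges_def complete_bipartite_def doubleton_eq_iff)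
  have arc: "(sw u, sw v) \<in> parcs (complete_bipartite b a) \<longleftrightarrow>
      (u, v) \<in> parcs (complete_bipartite a b)" for u v a b
    by (cases u; cases v) (auto simp: complete_bipartite_def)
  have vert: "sw u \<in> pverts (complete_bipartite b a) \<longleftrightarrow>
      u \<in> pverts (complete_bipartite a b)" for u a b
    by (cases u) (auto simp: complete_bipartite_def)
  have mem: "sw ` S \<in> I b a" if "S \<in> I a b" for S a b
    using that by (auto simp: I_def indep_def edge_iff arc vert)
  have "bij_betw ((`) sw) (I a b) (I b a)"
    by (rule bij_betw_byWitness[where f' = "(`) sw"]) (auto simp: image_image mem)
  then show ?thesis
    by (auto simp: num_indep_def I_def dest: bij_betw_same_card)
qed

text \<open>
  The components \<open>\<H>\<close> are given as actual subgraphs on pairwise disjoint vertex sets. The empty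
  union, i.e. the graph without vertices, is included.
\<close>

definition disjoint_union_of :: "'a pair_pre_digraph set \<Rightarrow> 'a pair_pre_digraph \<Rightarrow> bool" where
  "disjoint_union_of \<H> G \<longleftrightarrow> disjoint_family_on pverts \<H> \<and>
    pverts G = (\<Union>H\<in>\<H>. pverts H) \<and> parcs G = (\<Union>H\<in>\<H>. parcs H)"

definition disjoint_union_complete_bipartite :: "'a pair_pre_digraph \<Rightarrow> bool" where
  "disjoint_union_complete_bipartite G \<longleftrightarrow> (\<exists>\<H>. disjoint_union_of \<H> G \<and>
    (\<forall>H\<in>\<H>. \<exists>a\<ge>1. \<exists>b\<ge>1. complete_bipartite_digraph a b (with_proj H)))"

end

theory Submission
  imports Defs
begin

text \<open>
  Write \<open>N u\<close> for the neighbourhood of a vertex \<open>u\<close> and \<open>d\<^sub>u\<close> for its degree.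

  \<^bold>\<open>Reduction to a bipartite graph.\<close> Two copies \<open>A\<close>, \<open>B\<close> of the vertex set, where \<open>u \<in> A\<close> is joined
  to \<open>v \<in> B\<close> whenever \<open>uv\<close> is an edge of \<open>G\<close>, form the bipartite double cover of \<open>G\<close>. Zhao's swapping
  argument (\<open>num_indep_square_le\<close>) shows that it has at least \<open>i(G)\<^sup>2\<close> independent sets, and its edge
  product is the square of the edge product of \<open>G\<close>, because every edge is covered twice and degrees
  are kept. So the inequality is needed only for the double cover.

  \<^bold>\<open>Elimination.\<close> For \<open>S \<subseteq> A\<close> each \<open>v \<in> B\<close> can be added freely if no neighbour of \<open>v\<close> lies in \<open>S\<close>, and
  cannot be added otherwise; hence the number of independent sets is
  \<open>\<Sum>\<^bsub>S \<subseteq> A\<^esub> \<Prod>\<^bsub>v \<in> B\<^esub> (if S \<inter> N v = {} then 2 else 1)\<close>.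
  The vertices \<open>u \<in> A\<close> are summed out one at a time, in order of increasing degree. A vertex \<open>u\<close> occurs
  in exactly \<open>d\<^sub>u\<close> factors, so Hoelder's inequality with exponent \<open>d\<^sub>u\<close> lets each of these factors be
  summed out on its own. This keeps the shape of the expression and only changes the number \<open>2\<close> in the
  factor of \<open>v\<close>, into a value that depends on the neighbours of \<open>v\<close> eliminated so far. The claim
  that drives the induction is that this value is at most what one expects if \<open>v\<close> had no other
  neighbours: the product of the normalised numbers \<open>i(K\<^bsub>d\<^sub>u,k\<^esub>)\<^bsup>1/(k d\<^sub>u)\<^esup>\<close> over the \<open>k\<close> eliminated neighbours
  \<open>u\<close> (\<open>star_norm\<close> and \<open>star_norm_insert\<close>).

  \<^bold>\<open>The local inequality.\<close> That claim reduces, again by Hoelder, to an inequality for one previously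
  eliminated neighbour of degree \<open>a\<close> and the new one of degree \<open>D \<ge> a\<close> (\<open>local_inequality\<close>). With
  \<open>p = D / a \<ge> 1\<close> it says that the distribution \<open>P\<close> which a uniformly random independent set of
  \<open>K\<^bsub>a,k+1\<^esub>\<close> induces on the side of size \<open>k + 1\<close> satisfies \<open>\<Sum> P\<^bsup>p\<^esup> \<ge> \<Sum> R\<^bsup>p\<^esup>\<close>, where \<open>R\<close> is the product
  of the one-vertex marginals of \<open>P\<close>. It holds because \<open>P\<close> is a mixture of product distributions:
  Jensen's inequality gives \<open>\<Sum> P R\<^bsup>p-1\<^esup> \<ge> \<Sum> R\<^bsup>p\<^esup>\<close>, and the tangent of \<open>x\<^bsup>p\<^esup>\<close> at \<open>R\<close> does the rest. The order of
  elimination matters only through \<open>p \<ge> 1\<close>.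

  \<^bold>\<open>Equality.\<close> The local inequality is strict for \<open>p > 1\<close>, so equality forces all neighbours of a vertex
  to have the same degree. When \<open>u\<close> is eliminated before \<open>u'\<close>, Hoelder's inequality for the term in which
  \<open>u'\<close> alone is chosen is strict if \<open>u'\<close> is adjacent to some but not all neighbours of \<open>u\<close>. So two
  vertices of \<open>A\<close> with a common neighbour have nested neighbourhoods of the same size, that is, equal
  neighbourhoods, and the same then holds in \<open>G\<close>. A graph
  with this property, without isolated vertices, is a disjoint union of complete bipartite graphs.
  Conversely, both sides are multiplicative over disjoint unions and agree on \<open>K\<^bsub>a,b\<^esub>\<close>.
\<close>

section \<open>Strict mean inequalities\<close>

lemma ln_less_minus_one:
  fixes x :: real
  assumes "x > 0" "x \<noteq> 1"
  shows "ln x < x - 1"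
  using assms ln_le_minus_one[of x] ln_eq_minus_one[of x] by fastforce

text \<open>
  The arithmetic-geometric mean inequality together with its strict form, which the analysis of
  equality needs. It is the sum of \<open>ln y \<le> y - 1\<close> over the numbers \<open>y\<close> obtained by dividing each
  \<open>x i\<close> by the mean.
\<close>

lemma am_gm_powr:
  fixes x :: "'i \<Rightarrow> real"
  assumes fin: "finite I" and ne: "I \<noteq> {}" and pos: "\<And>i. i \<in> I \<Longrightarrow> x i > 0"
  shows "(\<Prod>i\<in>I. x i powr (1 / card I)) \<le> (\<Sum>i\<in>I. x i) / card I"
    and "\<lbrakk>i \<in> I; j \<in> I; x i \<noteq> x j\<rbrakk> \<Longrightarrow> (\<Prod>i\<in>I. x i powr (1 / card I)) < (\<Sum>i\<in>I. x i) / card I"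
proof -
  define n where "n = real (card I)"
  define \<mu> where "\<mu> = (\<Sum>i\<in>I. x i) / n"
  have n: "n > 0" using fin ne by (simp add: n_def card_gt_0_iff)
  have \<mu>: "\<mu> > 0" unfolding \<mu>_def using n fin ne pos by (intro divide_pos_pos sum_pos) auto
  have eq: "(\<Prod>i\<in>I. x i powr (1 / n)) = \<mu> * exp ((\<Sum>i\<in>I. ln (x i / \<mu>)) / n)"
  proof -
    have "(\<Sum>i\<in>I. ln (x i / \<mu>)) = (\<Sum>i\<in>I. ln (x i)) - n * ln \<mu>"
    proof -
      have "(\<Sum>i\<in>I. ln (x i / \<mu>)) = (\<Sum>i\<in>I. ln (x i) - ln \<mu>)"
        using pos \<mu> by (intro sum.cong) (auto simp: ln_div dest: pos)
      then show ?thesis by (simp add: sum_subtractf n_def)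
    qed
    then have "(\<Sum>i\<in>I. ln (x i / \<mu>)) / n = (\<Sum>i\<in>I. ln (x i)) / n - ln \<mu>"
      using n by (simp add: field_simps)
    then have "\<mu> * exp ((\<Sum>i\<in>I. ln (x i / \<mu>)) / n) = exp (\<Sum>i\<in>I. ln (x i) / n)"
      using \<mu> by (simp add: exp_diff sum_divide_distrib)
    also have "\<dots> = (\<Prod>i\<in>I. x i powr (1 / n))"
      unfolding exp_sum[OF fin] using less_imp_neq[OF pos] by (intro prod.cong) (auto simp: powr_def)
    finally show ?thesis ..
  qed
  have "(\<Sum>i\<in>I. x i) = n * \<mu>" unfolding \<mu>_def using n by simp
  then have zero: "(\<Sum>i\<in>I. x i / \<mu> - 1) = 0"
    using \<mu> by (simp add: sum_subtractf n_def flip: sum_divide_distrib)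
  have le: "(\<Sum>i\<in>I. ln (x i / \<mu>)) \<le> 0"
    unfolding zero[symmetric] using pos \<mu> by (intro sum_mono ln_le_minus_one) auto
  then have "exp ((\<Sum>i\<in>I. ln (x i / \<mu>)) / n) \<le> 1"
    using n by (simp add: divide_nonpos_pos)
  then show "(\<Prod>i\<in>I. x i powr (1 / card I)) \<le> (\<Sum>i\<in>I. x i) / card I"
    using eq \<mu> unfolding n_def[symmetric] \<mu>_def[symmetric] by simp
  assume ij: "i \<in> I" "j \<in> I" "x i \<noteq> x j"
  then obtain l where l: "l \<in> I" "x l \<noteq> \<mu>" by metis
  have "(\<Sum>i\<in>I. ln (x i / \<mu>)) < (\<Sum>i\<in>I. x i / \<mu> - 1)"
    using fin pos \<mu> l by (intro sum_strict_mono_ex1 ballI ln_le_minus_one bexI[of _ l] ln_less_minus_one) auto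
  then have "exp ((\<Sum>i\<in>I. ln (x i / \<mu>)) / n) < 1"
    using n zero by (simp add: divide_neg_pos)
  then show "(\<Prod>i\<in>I. x i powr (1 / card I)) < (\<Sum>i\<in>I. x i) / card I"
    using eq \<mu> unfolding n_def[symmetric] \<mu>_def[symmetric] by simp
qed

text \<open>
  Hoelder's inequality for \<open>n = card I\<close> functions on a space with two points of mass \<open>1\<close>, where the
  \<open>i\<close>-th function takes the values \<open>x i\<close> and \<open>1\<close>. After division by the right-hand side each
  of the two summands is a geometric mean, and the two arithmetic means that bound them add up to \<open>1\<close>.
\<close>

lemma hoelder_two_point:
  fixes x :: "'i \<Rightarrow> real"
  assumes fin: "finite I" and ne: "I \<noteq> {}" and pos: "\<And>i. i \<in> I \<Longrightarrow> x i > 0"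
  shows "(\<Prod>i\<in>I. x i) + 1 \<le> (\<Prod>i\<in>I. (x i powr card I + 1) powr (1 / card I))"
    and "\<lbrakk>i \<in> I; j \<in> I; x i \<noteq> x j\<rbrakk> \<Longrightarrow>
      (\<Prod>i\<in>I. x i) + 1 < (\<Prod>i\<in>I. (x i powr card I + 1) powr (1 / card I))"
proof -
  define n where "n = real (card I)"
  have n: "n > 0" using fin ne by (simp add: n_def card_gt_0_iff)
  define q where "q i = x i powr n / (x i powr n + 1)" for i
  define r where "r i = 1 / (x i powr n + 1)" for i
  have xp: "x i powr n > 0" if "i \<in> I" for i using pos[OF that] by simp
  have q: "q i > 0" if "i \<in> I" for i using xp[OF that] by (simp add: q_def add_pos_pos)
  have r: "r i > 0" for i using powr_ge_zero[of "x i" n] unfolding r_def by (simp add: add_nonneg_pos)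
  define P where "P = (\<Prod>i\<in>I. (x i powr n + 1) powr (1 / n))"
  have P: "P > 0" unfolding P_def by (intro prod_pos) (smt (verit) powr_ge_zero powr_gt_zero)
  have qe: "(\<Prod>i\<in>I. q i powr (1 / n)) = (\<Prod>i\<in>I. x i) / P"
    unfolding P_def prod_dividef[symmetric]
  proof (rule prod.cong)
    fix i assume i: "i \<in> I"
    show "q i powr (1 / n) = x i / (x i powr n + 1) powr (1 / n)"
      using pos[OF i] n unfolding q_def by (simp add: powr_divide powr_powr)
  qed simp
  have re: "(\<Prod>i\<in>I. r i powr (1 / n)) = 1 / P"
  proof -
    have "(\<Prod>i\<in>I. r i powr (1 / n)) = (\<Prod>i\<in>I. 1 / (x i powr n + 1) powr (1 / n))"
      unfolding r_def by (intro prod.cong) (simp_all add: powr_divide)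
    then show ?thesis unfolding P_def by (simp only: prod_dividef prod.neutral_const)
  qed
  have qr: "q i + r i = 1" for i
    using powr_ge_zero[of "x i" n]
    unfolding q_def r_def by (simp add: add_divide_distrib[symmetric] add_nonneg_eq_0_iff)
  have "(\<Sum>i\<in>I. q i) + (\<Sum>i\<in>I. r i) = (\<Sum>i\<in>I. 1)"
    unfolding sum.distrib[symmetric] qr ..
  then have one: "(\<Sum>i\<in>I. q i) / n + (\<Sum>i\<in>I. r i) / n = 1"
    using n by (simp add: n_def add_divide_distrib[symmetric])
  have r_le: "1 / P \<le> (\<Sum>i\<in>I. r i) / n"
    using am_gm_powr(1)[OF fin ne, of r] r re unfolding n_def by simp
  have "(\<Prod>i\<in>I. x i) / P \<le> (\<Sum>i\<in>I. q i) / n"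
    using am_gm_powr(1)[OF fin ne, of q] q qe unfolding n_def by simp
  with r_le one have "((\<Prod>i\<in>I. x i) + 1) / P \<le> 1" by (simp add: add_divide_distrib)
  then show "(\<Prod>i\<in>I. x i) + 1 \<le> (\<Prod>i\<in>I. (x i powr card I + 1) powr (1 / card I))"
    using P unfolding P_def n_def by (simp add: divide_le_eq)
  assume ij: "i \<in> I" "j \<in> I" "x i \<noteq> x j"
  have "q i \<noteq> q j"
  proof
    assume "q i = q j"
    moreover have "x l powr n = q l / (1 - q l)" for l
    proof -
      have "1 - q l = r l" using qr[of l] by simp
      then show ?thesis
        using powr_ge_zero[of "x l" n] by (simp add: q_def r_def add_nonneg_eq_0_iff)
    qed
    ultimately have "x i powr n = x j powr n"
      using ij by metis
    then have "ln (x i) = ln (x j)"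
      using ij pos n by (metis ln_powr less_imp_neq mult_cancel_left)
    then show False using ij pos by simp
  qed
  then have "(\<Prod>i\<in>I. x i) / P < (\<Sum>i\<in>I. q i) / n"
    using am_gm_powr(2)[OF fin ne, of q i j] q qe ij unfolding n_def by simp
  with r_le one have "((\<Prod>i\<in>I. x i) + 1) / P < 1" by (simp add: add_divide_distrib)
  then show "(\<Prod>i\<in>I. x i) + 1 < (\<Prod>i\<in>I. (x i powr card I + 1) powr (1 / card I))"
    using P unfolding P_def n_def by (simp add: divide_less_eq)
qed

text \<open>
  Bernoulli's inequality for real exponents: \<open>x\<close> is the weighted geometric mean of \<open>x powr p\<close> and \<open>1\<close>
  with weights \<open>1/p\<close> and \<open>1 - 1/p\<close>, and the claim bounds it by the arithmetic mean \<open>M\<close> with the same weights.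
\<close>

lemma bernoulli_powr:
  fixes x p :: real
  assumes "x > 0" "p \<ge> 1"
  shows "1 + p * (x - 1) \<le> x powr p"
    and "\<lbrakk>x \<noteq> 1; p > 1\<rbrakk> \<Longrightarrow> 1 + p * (x - 1) < x powr p"
proof -
  define M where "M = (x powr p + (p - 1)) / p"
  have M: "M > 0" unfolding M_def using assms by (simp add: add_pos_nonneg)
  have id: "p * (ln x - ln M) = ln (x powr p / M) + (p - 1) * ln (1 / M)"
    using assms M by (simp add: ln_div ln_powr algebra_simps)
  have z: "(x powr p / M - 1) + (p - 1) * (1 / M - 1) = 0"
    using M assms unfolding M_def by (simp add: field_simps)
  have l1: "ln (x powr p / M) \<le> x powr p / M - 1" and l2: "(p - 1) * ln (1 / M) \<le> (p - 1) * (1 / M - 1)"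
    using assms M by (intro ln_le_minus_one mult_left_mono; simp)+
  have "p * (ln x - ln M) \<le> 0" using l1 l2 z id by linarith
  then have "x \<le> M" using assms M by (simp add: mult_le_0_iff)
  then show "1 + p * (x - 1) \<le> x powr p" using assms unfolding M_def by (simp add: field_simps)
  assume s: "x \<noteq> 1" "p > 1"
  have "(p - 1) * ln (1 / M) < (p - 1) * (1 / M - 1) \<or> ln (x powr p / M) < x powr p / M - 1"
  proof (cases "M = 1")
    case True
    have "x powr p \<noteq> 1" using s assms by (simp add: powr_def)
    then show ?thesis using True assms ln_less_minus_one[of "x powr p / M"] by simp
  next
    case False
    then show ?thesis using M s ln_less_minus_one[of "1 / M"] by simp
  qed
  then have "p * (ln x - ln M) < 0" using l1 l2 z id by linarith
  then have "x < M" using assms M by (simp add: mult_less_0_iff)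
  then show "1 + p * (x - 1) < x powr p" using assms unfolding M_def by (simp add: field_simps)
qed

section \<open>The local inequality\<close>

lemma powr_tangent:
  fixes P R p :: real
  assumes "P > 0" "R > 0" "p \<ge> 1"
  shows "R powr p + p * (P * R powr (p - 1) - R powr p) \<le> P powr p"
proof -
  have eq: "R powr (p - 1) = R powr p / R" using assms by (simp add: powr_diff)
  have "(1 + p * (P / R - 1)) * R powr p \<le> (P / R) powr p * R powr p"
    using bernoulli_powr(1)[of "P / R" p] assms by (intro mult_right_mono) auto
  also have "\<dots> = P powr p" using assms by (simp add: powr_divide)
  finally show ?thesis unfolding eq using assms by (simp add: algebra_simps)
qed

lemma power_powr_swap: "x > 0 \<Longrightarrow> (x ^ n) powr q = (x powr q) ^ n" for x q :: real
  by (simp add: powr_realpow[symmetric] powr_powr mult.commute)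

lemma power_tangent:
  fixes x m :: real and n :: nat
  assumes "x > 0" "m > 0" "n \<ge> 1"
  shows "m ^ n + n * m ^ (n - 1) * (x - m) \<le> x ^ n"
    and "\<lbrakk>x \<noteq> m; n \<ge> 2\<rbrakk> \<Longrightarrow> m ^ n + n * m ^ (n - 1) * (x - m) < x ^ n"
proof -
  have eq: "m ^ n = m * m ^ (n - 1)" using assms by (simp flip: power_Suc)
  have l: "m ^ n + n * m ^ (n - 1) * (x - m) = (1 + n * (x / m - 1)) * m ^ n"
    unfolding eq using assms by (simp add: field_simps)
  have r: "x ^ n = (x / m) powr n * m ^ n"
    using assms by (simp add: powr_realpow power_divide)
  show "m ^ n + n * m ^ (n - 1) * (x - m) \<le> x ^ n"
    unfolding l r using bernoulli_powr(1)[of "x / m" n] assms by (intro mult_right_mono) auto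
  assume "x \<noteq> m" "n \<ge> 2"
  then show "m ^ n + n * m ^ (n - 1) * (x - m) < x ^ n"
    unfolding l r using bernoulli_powr(2)[of "x / m" n] assms by (intro mult_strict_right_mono) auto
qed

text \<open>
  Jensen's inequality for \<open>x\<^bsup>n\<^esup>\<close> and two points of weights \<open>w\<close> and \<open>1\<close>, by comparison with the tangent at
  their mean.
\<close>

lemma weighted_power_mean:
  fixes s t w :: real and n :: nat
  assumes "s > 0" "t > 0" "w > 0" "n \<ge> 1"
  shows "(w + 1) * ((w * s + t) / (w + 1)) ^ n \<le> w * s ^ n + t ^ n"
    and "\<lbrakk>s \<noteq> t; n \<ge> 2\<rbrakk> \<Longrightarrow> (w + 1) * ((w * s + t) / (w + 1)) ^ n < w * s ^ n + t ^ n"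
proof -
  define m where "m = (w * s + t) / (w + 1)"
  have m: "m > 0" unfolding m_def using assms by (simp add: add_pos_pos)
  have wm: "(w + 1) * m = w * s + t" unfolding m_def using assms by simp
  define D where "D = n * m ^ (n - 1)"
  have z: "w * (m ^ n + D * (s - m)) + (m ^ n + D * (t - m)) = (w + 1) * m ^ n"
  proof -
    have "w * (m ^ n + D * (s - m)) + (m ^ n + D * (t - m))
        = (w + 1) * m ^ n + D * (w * s + t - (w + 1) * m)" by algebra
    then show ?thesis using wm by simp
  qed
  have s: "w * (m ^ n + D * (s - m)) \<le> w * s ^ n"
    using power_tangent(1)[of s m n] assms m unfolding D_def by simp
  have t: "m ^ n + D * (t - m) \<le> t ^ n"
    using power_tangent(1)[of t m n] assms m unfolding D_def by simp
  show "(w + 1) * ((w * s + t) / (w + 1)) ^ n \<le> w * s ^ n + t ^ n"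
    using s t z unfolding m_def[symmetric] by linarith
  assume st: "s \<noteq> t" "n \<ge> 2"
  have "t \<noteq> m"
  proof
    assume "t = m"
    then have "w = 0 \<or> m = s" using wm by (simp add: algebra_simps)
    then show False using st assms \<open>t = m\<close> by simp
  qed
  then have "m ^ n + D * (t - m) < t ^ n"
    using power_tangent(2)[of t m n] assms m st unfolding D_def by simp
  then show "(w + 1) * ((w * s + t) / (w + 1)) ^ n < w * s ^ n + t ^ n"
    using s z unfolding m_def[symmetric] by linarith
qed

text \<open>
  For \<open>A = 2 ^ a\<close> this is \<open>i(K\<^bsub>a,k\<^esub>) / 2 ^ k\<close>. A real argument \<open>A\<close> is convenient, because it allows
  passing from \<open>2 ^ a\<close> to another power of two through a real exponent.
\<close>

definition biclique_ratio :: "real \<Rightarrow> nat \<Rightarrow> real" where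
  "biclique_ratio A k = 1 + (A - 1) / 2 ^ k"

lemma biclique_ratio_gt_1: "A > 1 \<Longrightarrow> biclique_ratio A k > 1"
  by (simp add: biclique_ratio_def)

lemma biclique_ratio_Suc: "biclique_ratio A (Suc k) = (biclique_ratio A k + 1) / 2"
  by (simp add: biclique_ratio_def field_simps)

text \<open>
  Put \<open>d = k + 1\<close>, \<open>z = biclique_ratio A k\<close> and \<open>z' = biclique_ratio A d = (z + 1) / 2\<close>. On the
  subsets of a set of size \<open>d\<close>, under the uniform measure, let \<open>P\<close> be \<open>A\<close> at the empty set and \<open>1\<close>
  elsewhere; for \<open>A = 2 ^ a\<close> this is, up to scaling, the law of the trace of a random independent set of \<open>K\<^bsub>a,d\<^esub>\<close> on
  the side of size \<open>d\<close>. The ratio of the probabilities of omitting and taking a given vertex is \<open>z\<close>,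
  so the product of the marginals, in the same scaling, is \<open>R = z ^ (d - j) / z' ^ k\<close> at a set of size \<open>j\<close>.
  The inequality is \<open>E R\<^bsup>p\<^esup> \<le> E P\<^bsup>p\<^esup>\<close>. By the tangent of \<open>x\<^bsup>p\<^esup>\<close> at \<open>R\<close> it suffices that
  \<open>E R\<^bsup>p\<^esup> \<le> E P R\<^bsup>p-1\<^esup>\<close>. Since \<open>P\<close> is the mixture of a point mass at the empty set, of weight
  \<open>w = (A - 1) / 2 ^ d\<close>, and the uniform law, of weight \<open>1\<close>, and since \<open>R\<^bsup>p-1\<^esup>\<close> is a product, the
  expectation \<open>E P R\<^bsup>p-1\<^esup>\<close> is \<open>w s\<^bsup>d\<^esup> + t\<^bsup>d\<^esup>\<close> up to scaling, and Jensen's inequality applies.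
\<close>

lemma local_inequality:
  fixes A p :: real and k :: nat
  assumes A: "A > 1" and p: "p \<ge> 1"
  shows "((biclique_ratio A k powr p + 1) / 2) ^ Suc k
      \<le> biclique_ratio (A powr p) (Suc k) * (biclique_ratio A (Suc k) powr p) ^ k"
    and "\<lbrakk>p > 1; k \<ge> 1\<rbrakk> \<Longrightarrow> ((biclique_ratio A k powr p + 1) / 2) ^ Suc k
      < biclique_ratio (A powr p) (Suc k) * (biclique_ratio A (Suc k) powr p) ^ k"
proof -
  define z where "z = biclique_ratio A k"
  define z' where "z' = (z + 1) / 2"
  have z'k: "z' = biclique_ratio A (Suc k)" unfolding z'_def z_def by (simp add: biclique_ratio_Suc)
  have z: "z > 1" using biclique_ratio_gt_1[OF A] by (simp add: z_def)
  have z': "z' > 1" using z by (simp add: z'_def)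
  define d where "d = Suc k"
  define w where "w = (A - 1) / 2 ^ d"
  have w: "w > 0" using A by (simp add: w_def)
  have z'w: "z' = w + 1" unfolding z'k biclique_ratio_def w_def d_def by simp
  define c where "c = z' ^ k"
  have c: "c > 0" using z' by (simp add: c_def)
  define M where "M = (z powr p + 1) / 2"
  define P where "P j = (if j = 0 then A else 1)" for j :: nat
  define R where "R j = z ^ (d - j) / c" for j
  define W where "W j = real (d choose j) / 2 ^ d" for j
  have P: "P j > 0" for j using A by (simp add: P_def)
  have R: "R j > 0" for j using z c by (simp add: R_def)
  have W: "W j \<ge> 0" for j by (simp add: W_def)
  \<comment> \<open>All functions of a subset that occur below depend only on its size \<open>j\<close>, so expectations are binomial sums.\<close>
  have binom: "(\<Sum>j\<le>d. W j * y ^ (d - j)) = ((y + 1) / 2) ^ d" for y :: real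
  proof -
    have "(y + 1) ^ d = (\<Sum>j\<le>d. real (d choose j) * y ^ (d - j))"
      using binomial_ring[of 1 y d] by (simp add: add.commute)
    then show ?thesis by (simp add: W_def power_divide sum_divide_distrib)
  qed
  have at_0: "(\<Sum>j\<le>d. W j * (if j = 0 then u else v) * f j) = (u - v) / 2 ^ d * f 0 + v * (\<Sum>j\<le>d. W j * f j)"
    for u v :: real and f
    by (simp add: sum.atMost_shift sum_distrib_left algebra_simps) (simp add: W_def field_simps)
  have Rpow: "R j powr q = (z powr q) ^ (d - j) / c powr q" for j q
    using z c unfolding R_def by (simp add: powr_divide power_powr_swap)
  have ER: "(\<Sum>j\<le>d. W j * R j powr p) = M ^ d / c powr p"
    using binom[of "z powr p"] unfolding Rpow M_def by (simp add: sum_divide_distrib[symmetric])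
  have EP: "(\<Sum>j\<le>d. W j * P j powr p) = biclique_ratio (A powr p) d"
  proof -
    have "(\<Sum>j\<le>d. W j * P j powr p) = (\<Sum>j\<le>d. W j * (if j = 0 then A powr p else 1) * 1)"
      by (intro sum.cong) (auto simp: P_def)
    then show ?thesis unfolding at_0 using binom[of 1] by (simp add: biclique_ratio_def)
  qed
  define s where "s = z powr (p - 1)"
  define t where "t = (s + 1) / 2"
  have s: "s > 0" using z by (simp add: s_def)
  have t: "t > 0" using s by (simp add: t_def)
  have sz: "s * z = z powr p" unfolding s_def using z by (simp add: powr_diff)
  have mean: "w * s + t = M"
    using z'w unfolding t_def M_def sz[symmetric] z'_def by (simp add: field_simps)
  have cc: "c powr p = c powr (p - 1) * c" using c by (simp add: powr_diff)
  have EPR: "(\<Sum>j\<le>d. W j * (P j * R j powr (p - 1))) = (w * s ^ d + t ^ d) / c powr (p - 1)"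
  proof -
    have "(\<Sum>j\<le>d. W j * (P j * R j powr (p - 1))) = (\<Sum>j\<le>d. W j * (if j = 0 then A else 1) * s ^ (d - j)) / c powr (p - 1)"
      unfolding Rpow s_def[symmetric] by (auto simp: P_def sum_divide_distrib intro!: sum.cong)
    then show ?thesis unfolding at_0 using binom[of s] by (simp add: w_def t_def)
  qed
  have target: "(w + 1) * ((w * s + t) / (w + 1)) ^ d / c powr (p - 1) = M ^ d / c powr p"
    unfolding mean z'w[symmetric] cc using z' c by (simp add: d_def c_def power_divide)
  have le: "M ^ d / c powr p \<le> (\<Sum>j\<le>d. W j * (P j * R j powr (p - 1)))"
    unfolding EPR target[symmetric] using weighted_power_mean(1)[OF s t w, of d] c
    by (intro divide_right_mono) (auto simp: d_def)
  have "(\<Sum>j\<le>d. W j * (R j powr p + p * (P j * R j powr (p - 1) - R j powr p))) \<le> (\<Sum>j\<le>d. W j * P j powr p)"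
    using P R W p by (intro sum_mono mult_left_mono powr_tangent) auto
  also have "(\<Sum>j\<le>d. W j * (R j powr p + p * (P j * R j powr (p - 1) - R j powr p)))
      = M ^ d / c powr p + p * ((\<Sum>j\<le>d. W j * (P j * R j powr (p - 1))) - M ^ d / c powr p)"
    unfolding ER[symmetric] by (simp add: algebra_simps sum.distrib sum_subtractf sum_distrib_left)
  finally have tangent: "M ^ d / c powr p + p * ((\<Sum>j\<le>d. W j * (P j * R j powr (p - 1))) - M ^ d / c powr p)
      \<le> biclique_ratio (A powr p) d" unfolding EP .
  have cp: "c powr p = (z' powr p) ^ k" "c powr p > 0"
    using z' by (simp_all add: c_def power_powr_swap)
  have "0 \<le> p * ((\<Sum>j\<le>d. W j * (P j * R j powr (p - 1))) - M ^ d / c powr p)"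
    using le p by simp
  then have "M ^ d / c powr p \<le> biclique_ratio (A powr p) d" using tangent by linarith
  then show "((biclique_ratio A k powr p + 1) / 2) ^ Suc k \<le> biclique_ratio (A powr p) (Suc k) * (biclique_ratio A (Suc k) powr p) ^ k"
    using cp unfolding z_def[symmetric] M_def[symmetric]
    by (simp add: divide_le_eq z'k d_def)
  assume strict: "p > 1" "k \<ge> 1"
  have "s > 1" unfolding s_def using z strict by simp
  then have "s \<noteq> t" by (simp add: t_def)
  then have "M ^ d / c powr p < (\<Sum>j\<le>d. W j * (P j * R j powr (p - 1)))"
    unfolding EPR target[symmetric] using weighted_power_mean(2)[OF s t w, of d] c strict
    by (intro divide_strict_right_mono) (auto simp: d_def)
  then have "0 < p * ((\<Sum>j\<le>d. W j * (P j * R j powr (p - 1))) - M ^ d / c powr p)"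
    using p by simp
  then have "M ^ d / c powr p < biclique_ratio (A powr p) d" using tangent by linarith
  then show "((biclique_ratio A k powr p + 1) / 2) ^ Suc k < biclique_ratio (A powr p) (Suc k) * (biclique_ratio A (Suc k) powr p) ^ k"
    using cp unfolding z_def[symmetric] M_def[symmetric]
    by (simp add: divide_less_eq z'k d_def)
qed

section \<open>The factor of a single vertex\<close>

text \<open>
  The bound for the factor of a vertex \<open>v\<close> after elimination of its neighbours \<open>i \<in> I\<close> of degrees \<open>a i\<close>.
  Before any elimination the factor is \<open>2\<close>: the vertex \<open>v\<close> is in or out.
\<close>

definition star_norm :: "('i \<Rightarrow> nat) \<Rightarrow> 'i set \<Rightarrow> real" where
  "star_norm a I = (if I = {} then 2
    else (\<Prod>i\<in>I. biclique_ratio (2 ^ a i) (card I) powr (1 / (real (card I) * real (a i)))))"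

lemma star_norm_gt_1:
  assumes "finite I" "\<And>i. i \<in> I \<Longrightarrow> a i \<ge> 1"
  shows "star_norm a I > 1"
proof (cases "I = {}")
  case False
  have "1 < biclique_ratio (2 ^ a i) (card I) powr (1 / (real (card I) * real (a i)))" if i: "i \<in> I" for i
  proof -
    have "(1::real) < 2 ^ a i" using assms(2)[OF i] by simp
    moreover have "card I > 0" using assms(1) False by (simp add: card_gt_0_iff)
    ultimately show ?thesis using assms(2)[OF i] by (simp add: biclique_ratio_gt_1)
  qed
  then show ?thesis using False assms(1) by (simp add: star_norm_def less_1_prod)
qed (simp add: star_norm_def)

text \<open>
  The left-hand side is what averaging over the new neighbour \<open>x\<close> makes of the bound for \<open>I\<close>.
  Raised to the power \<open>a x\<close>, the bound for \<open>I\<close> is a product over \<open>I\<close>; Hoelder's inequality splits the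
  average into one average for each \<open>i \<in> I\<close>, and \<open>local_inequality\<close> with \<open>p = a x / a i\<close>
  bounds each of them. The factors that belong to the new neighbour \<open>x\<close>, one from each \<open>i\<close>, multiply to the factor
  of \<open>x\<close> in the bound for \<open>insert x I\<close>.
\<close>

lemma star_norm_insert:
  assumes fin: "finite I" and new: "x \<notin> I"
    and a: "\<And>i. i \<in> I \<Longrightarrow> 1 \<le> a i" "\<And>i. i \<in> I \<Longrightarrow> a i \<le> a x" and ax: "1 \<le> a x"
  shows "((star_norm a I powr a x + 1) / 2) powr (1 / a x) \<le> star_norm a (insert x I)"
    and "\<exists>i\<in>I. a i < a x \<Longrightarrow>
      ((star_norm a I powr a x + 1) / 2) powr (1 / a x) < star_norm a (insert x I)"
proof -
  define \<Delta> where "\<Delta> = real (a x)"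
  define k where "k = card I"
  define Q where "Q = (star_norm a I powr \<Delta> + 1) / 2"
  define S where "S = star_norm a (insert x I) powr \<Delta>"
  have \<Delta>: "\<Delta> > 0" using ax by (simp add: \<Delta>_def)
  have Q: "Q \<ge> 0" by (simp add: Q_def)
  have S: "S powr (1 / \<Delta>) = star_norm a (insert x I)"
  proof -
    have "star_norm a (insert x I) > 1"
      using fin a ax by (intro star_norm_gt_1) auto
    then show ?thesis using \<Delta> by (simp add: S_def powr_powr)
  qed
  have "I = {} \<and> Q = S \<or> I \<noteq> {} \<and> Q \<le> S \<and> ((\<exists>i\<in>I. a i < a x) \<longrightarrow> Q < S)"
  proof (cases "I = {}")
    case True
    have "star_norm a (insert x I) = biclique_ratio (2 ^ a x) 1 powr (1 / \<Delta>)"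
      using True by (simp add: star_norm_def \<Delta>_def)
    moreover have "biclique_ratio (2 ^ a x) 1 > 0" using biclique_ratio_gt_1[of "2 ^ a x" 1] ax by simp
    ultimately have "S = biclique_ratio (2 ^ a x) 1" unfolding S_def using \<Delta> by (simp add: powr_powr)
    moreover have "Q = (2 ^ a x + 1) / 2"
      using True by (simp add: Q_def star_norm_def \<Delta>_def powr_realpow)
    ultimately show ?thesis using True by (simp add: biclique_ratio_def field_simps)
  next
    case False
    then have k: "k > 0" using fin by (simp add: k_def card_gt_0_iff)
    have cI: "card (insert x I) = Suc k" using fin new by (simp add: k_def)
    define p where "p i = \<Delta> / real (a i)" for i
    define z where "z i = biclique_ratio (2 ^ a i) k" for i
    define z' where "z' i = biclique_ratio (2 ^ a i) (Suc k)" for i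
    define y where "y = biclique_ratio (2 ^ a x) (Suc k)"
    have p: "p i \<ge> 1" if "i \<in> I" for i using a[OF that] by (simp add: p_def \<Delta>_def)
    have gt: "z i > 1" "z' i > 1" if "i \<in> I" for i
      using a(1)[OF that] by (simp_all add: z_def z'_def biclique_ratio_gt_1)
    have y: "y > 1" using ax by (simp add: y_def biclique_ratio_gt_1)
    have Apow: "(2 ^ a i) powr p i = (2 ^ a x :: real)" if "i \<in> I" for i
      using a(1)[OF that] by (simp add: p_def \<Delta>_def powr_powr flip: powr_realpow)
    have star: "star_norm a I powr \<Delta> = (\<Prod>i\<in>I. z i powr (p i / k))"
    proof -
      have "star_norm a I powr \<Delta> = (\<Prod>i\<in>I. z i powr (1 / (real k * real (a i)))) powr \<Delta>"
        using False by (simp add: star_norm_def k_def z_def)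
      also have "\<dots> = (\<Prod>i\<in>I. (z i powr (1 / (real k * real (a i)))) powr \<Delta>)"
        by (rule prod_powr_distrib)
      finally show ?thesis using gt k by (simp add: powr_powr p_def field_simps)
    qed
    have S_eq: "S = y powr (1 / Suc k) * (\<Prod>i\<in>I. z' i powr (p i / Suc k))"
    proof -
      have "star_norm a (insert x I) = y powr (1 / (Suc k * \<Delta>)) * (\<Prod>i\<in>I. z' i powr (1 / (real (Suc k) * real (a i))))"
        using fin new by (simp add: star_norm_def k_def z'_def y_def \<Delta>_def)
      then have "S = (y powr (1 / (Suc k * \<Delta>))) powr \<Delta> * (\<Prod>i\<in>I. z' i powr (1 / (real (Suc k) * real (a i)))) powr \<Delta>"
        unfolding S_def by (simp add: powr_mult prod_nonneg)
      also have "(\<Prod>i\<in>I. z' i powr (1 / (real (Suc k) * real (a i)))) powr \<Delta>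
          = (\<Prod>i\<in>I. (z' i powr (1 / (real (Suc k) * real (a i)))) powr \<Delta>)"
        by (rule prod_powr_distrib)
      finally show ?thesis using \<Delta> by (simp add: powr_powr p_def mult.commute del: of_nat_Suc)
    qed
    \<comment> \<open>The share of \<open>i\<close> in \<open>S\<close>, including an equal part of the factor of \<open>x\<close>.\<close>
    define u where "u i = (y powr (1 / Suc k) * z' i powr (p i * k / Suc k)) powr (1 / k)" for i
    have root: "(z i powr p i + 1) / 2 \<le> y powr (1 / Suc k) * z' i powr (p i * k / Suc k)"
      and root_strict: "a i < a x \<Longrightarrow> (z i powr p i + 1) / 2 < y powr (1 / Suc k) * z' i powr (p i * k / Suc k)"
      if i: "i \<in> I" for i
    proof -
      define v where "v = y powr (1 / Suc k) * z' i powr (p i * k / Suc k)"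
      have v: "v \<ge> 0" by (simp add: v_def)
      have vpow: "v ^ Suc k = y * (z' i powr p i) ^ k"
      proof -
        have "v ^ Suc k = (y powr (1 / Suc k)) ^ Suc k * (z' i powr (p i * k / Suc k)) ^ Suc k"
          unfolding v_def by (rule power_mult_distrib)
        also have "(y powr (1 / Suc k)) ^ Suc k = y"
          using y by (subst powr_realpow[symmetric]) (simp_all add: powr_powr del: of_nat_Suc)
        also have "(z' i powr (p i * k / Suc k)) ^ Suc k = (z' i powr p i) ^ k"
          using gt(2)[OF i] k
          by (subst (1 2) powr_realpow[symmetric]) (simp_all add: powr_powr del: of_nat_Suc)
        finally show ?thesis .
      qed
      have A: "(2::real) ^ a i > 1" using a(1)[OF i] by simp
      have "((z i powr p i + 1) / 2) ^ Suc k \<le> v ^ Suc k"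
        using local_inequality(1)[OF A p[OF i], of k] unfolding vpow Apow[OF i] z_def z'_def y_def .
      then show "(z i powr p i + 1) / 2 \<le> y powr (1 / Suc k) * z' i powr (p i * k / Suc k)"
        unfolding v_def[symmetric] using v by (rule power_le_imp_le_base)
      assume "a i < a x"
      then have "p i > 1" using a(1)[OF i] by (simp add: p_def \<Delta>_def)
      then have "((z i powr p i + 1) / 2) ^ Suc k < v ^ Suc k"
        using local_inequality(2)[OF A p[OF i], of k] k unfolding vpow Apow[OF i] z_def z'_def y_def by simp
      then show "(z i powr p i + 1) / 2 < y powr (1 / Suc k) * z' i powr (p i * k / Suc k)"
        unfolding v_def[symmetric] using v by (rule power_less_imp_less_base)
    qed
    have "(\<Prod>i\<in>I. z i powr (p i / k)) + 1 \<le> (\<Prod>i\<in>I. ((z i powr (p i / k)) powr k + 1) powr (1 / k))"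
      using hoelder_two_point(1)[OF fin False, of "\<lambda>i. z i powr (p i / k)"] gt unfolding k_def by force
    also have "\<dots> = (\<Prod>i\<in>I. 2 powr (1 / k) * ((z i powr p i + 1) / 2) powr (1 / k))"
    proof (rule prod.cong)
      fix i assume "i \<in> I"
      have "(z i powr (p i / k)) powr k + 1 = 2 * ((z i powr p i + 1) / 2)"
        using k by (simp add: powr_powr)
      then show "((z i powr (p i / k)) powr k + 1) powr (1 / k)
          = 2 powr (1 / k) * ((z i powr p i + 1) / 2) powr (1 / k)"
        by (simp only: powr_mult)
    qed simp
    also have "\<dots> = 2 * (\<Prod>i\<in>I. ((z i powr p i + 1) / 2) powr (1 / k))"
      using k by (simp add: prod.distrib k_def[symmetric] powr_realpow[symmetric] powr_powr)
    finally have Q_le: "Q \<le> (\<Prod>i\<in>I. ((z i powr p i + 1) / 2) powr (1 / k))"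
      unfolding Q_def star by simp
    have u_eq: "(\<Prod>i\<in>I. u i) = S"
    proof -
      have "u i = y powr (1 / Suc k / k) * z' i powr (p i / Suc k)" for i
        unfolding u_def using k by (simp add: powr_mult powr_powr)
      moreover have "(y powr (1 / Suc k / k)) ^ k = y powr (1 / Suc k)"
        using k y by (subst powr_realpow[symmetric]) (simp_all add: powr_powr)
      ultimately show ?thesis unfolding S_eq by (simp add: prod.distrib k_def[symmetric])
    qed
    have le: "((z i powr p i + 1) / 2) powr (1 / k) \<le> u i" if "i \<in> I" for i
      unfolding u_def using root[OF that] by (intro powr_mono2) auto
    have u_pos: "u i > 0" if "i \<in> I" for i
      using y gt(2)[OF that] by (simp add: u_def)
    have Q_le_S: "Q \<le> S"
      using Q_le prod_mono[of I "\<lambda>i. ((z i powr p i + 1) / 2) powr (1 / k)" u] le u_eq by force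
    moreover have "Q < S" if ex: "\<exists>i\<in>I. a i < a x"
    proof -
      obtain i where i: "i \<in> I" "a i < a x" using ex by blast
      have "((z i powr p i + 1) / 2) powr (1 / k) < u i"
        unfolding u_def using root_strict[OF i] k by (intro powr_less_mono2) auto
      then have "(\<Prod>i\<in>I. ((z i powr p i + 1) / 2) powr (1 / k)) < (\<Prod>i\<in>I. u i)"
        using i fin le u_pos by (intro prod_mono_strict[of i]) auto
      then show ?thesis using Q_le u_eq by simp
    qed
    ultimately show ?thesis using False by blast
  qed
  then have le: "Q \<le> S" and lt: "\<exists>i\<in>I. a i < a x \<Longrightarrow> Q < S" by auto
  show "((star_norm a I powr a x + 1) / 2) powr (1 / a x) \<le> star_norm a (insert x I)"
    unfolding S[symmetric] Q_def[symmetric] \<Delta>_def[symmetric]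
    using le Q \<Delta> unfolding Q_def by (intro powr_mono2) (simp_all add: \<Delta>_def)
  assume "\<exists>i\<in>I. a i < a x"
  then show "((star_norm a I powr a x + 1) / 2) powr (1 / a x) < star_norm a (insert x I)"
    unfolding S[symmetric] using lt Q \<Delta> unfolding Q_def \<Delta>_def by (intro powr_less_mono2) simp_all
qed

section \<open>Elimination in a bipartite graph\<close>

lemma sum_Pow_insert:
  fixes f :: "'a set \<Rightarrow> real"
  assumes "finite C" "x \<notin> C"
  shows "(\<Sum>T\<in>Pow (insert x C). f T) = (\<Sum>T\<in>Pow C. f T + f (insert x T))"
proof -
  have "inj_on (insert x) (Pow C)" using assms(2) by (auto simp: inj_on_def)
  moreover have "Pow C \<inter> insert x ` Pow C = {}" using assms(2) by auto
  ultimately show ?thesis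
    using assms(1) by (simp add: Pow_insert sum.union_disjoint sum.reindex sum.distrib)
qed

locale bipartite =
  fixes A :: "'a set" and B :: "'b set" and R :: "('a \<times> 'b) set"
  assumes finite_A: "finite A" and finite_B: "finite B" and R_sub: "R \<subseteq> A \<times> B"
    and no_isolated: "u \<in> A \<Longrightarrow> R `` {u} \<noteq> {}"
begin

abbreviation N :: "'a \<Rightarrow> 'b set" where "N u \<equiv> R `` {u}"
abbreviation M :: "'b \<Rightarrow> 'a set" where "M v \<equiv> R\<inverse> `` {v}"
abbreviation deg :: "'a \<Rightarrow> nat" where "deg u \<equiv> card (N u)"

text \<open>
  The factor of \<open>v \<in> B\<close> after elimination of \<open>E \<subseteq> A\<close>, if \<open>T \<subseteq> A - E\<close> is the chosen part of the rest. It
  is normalised to be \<open>1\<close> if \<open>v\<close> is blocked by \<open>T\<close>, so that averaging over an eliminated vertex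
  keeps this value; the missing powers of two are collected in the first factor of \<open>\<Phi>\<close>.
\<close>

definition factor :: "'a set \<Rightarrow> 'a set \<Rightarrow> 'b \<Rightarrow> real" where
  "factor E T v = (if T \<inter> M v = {} then star_norm deg (E \<inter> M v) else 1)"

text \<open>
  This interpolates between the number of independent sets (\<open>E = {}\<close>, lemma \<open>\<Phi>_empty\<close>) and the edge
  product (\<open>E = A\<close>, lemma \<open>\<Phi>_full\<close>).
\<close>

definition \<Phi> :: "'a set \<Rightarrow> real" where
  "\<Phi> E = 2 ^ card E * (\<Sum>T\<in>Pow (A - E). \<Prod>v\<in>B. factor E T v)"

lemma finite_N: "finite (N u)" and N_sub: "N u \<subseteq> B" and M_sub: "M v \<subseteq> A"
  using R_sub finite_B by (auto intro: finite_subset)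

lemma deg_ge_1: "u \<in> A \<Longrightarrow> 1 \<le> deg u"
  using no_isolated finite_N by (simp add: Suc_le_eq card_gt_0_iff)

lemma star_gt_1: "E \<subseteq> A \<Longrightarrow> star_norm deg (E \<inter> M v) > 1"
  using deg_ge_1 finite_A by (intro star_norm_gt_1) (auto intro: finite_subset)

lemma factor_ge_1: "E \<subseteq> A \<Longrightarrow> factor E T v \<ge> 1"
  using star_gt_1[of E v] by (simp add: factor_def)

lemma factor_pos: "E \<subseteq> A \<Longrightarrow> factor E T v > 0"
  using factor_ge_1[of E T v] by simp

lemma eliminate_factor:
  assumes u: "u \<in> A - E" and E: "E \<subseteq> A" and max: "\<And>y. y \<in> E \<Longrightarrow> deg y \<le> deg u"
    and v: "v \<in> N u"
  shows "((factor E T v powr deg u + 1) / 2) powr (1 / deg u) \<le> factor (insert u E) T v"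
    and "\<lbrakk>T \<inter> M v = {}; y \<in> E \<inter> M v; deg y < deg u\<rbrakk> \<Longrightarrow>
      ((factor E T v powr deg u + 1) / 2) powr (1 / deg u) < factor (insert u E) T v"
proof -
  have ins: "insert u E \<inter> M v = insert u (E \<inter> M v)" using v by auto
  have fin: "finite (E \<inter> M v)" using E finite_A by (auto intro: finite_subset)
  have new: "u \<notin> E \<inter> M v" using u by auto
  have d: "1 \<le> deg i" "deg i \<le> deg u" if "i \<in> E \<inter> M v" for i
    using that E max deg_ge_1[of i] by auto
  have du: "1 \<le> deg u" using u deg_ge_1 by auto
  show "((factor E T v powr deg u + 1) / 2) powr (1 / deg u) \<le> factor (insert u E) T v"
    using star_norm_insert(1)[of "E \<inter> M v" u deg, OF fin new d du] unfolding factor_def ins by simp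
  assume "T \<inter> M v = {}" "y \<in> E \<inter> M v" "deg y < deg u"
  then show "((factor E T v powr deg u + 1) / 2) powr (1 / deg u) < factor (insert u E) T v"
    using star_norm_insert(2)[of "E \<inter> M v" u deg, OF fin new d du] unfolding factor_def ins by auto
qed

text \<open>
  If \<open>u\<close> is chosen, all its neighbours are blocked and contribute \<open>1\<close>, while the other vertices of \<open>B\<close> do
  not notice \<open>u\<close>. Hence Hoelder's inequality with exponent \<open>deg u\<close> concerns only the \<open>deg u\<close> factors of
  the neighbours of \<open>u\<close>. The sum is strictly smaller than the bound if the estimate of one of these factors is
  strict, or if the factors are not all equal, as happens when \<open>T\<close> blocks some but not all neighbours
  of \<open>u\<close>.
\<close>

lemma eliminate_term:
  assumes u: "u \<in> A - E" and E: "E \<subseteq> A" and max: "\<And>y. y \<in> E \<Longrightarrow> deg y \<le> deg u"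
  shows "(\<Prod>v\<in>B. factor E T v) + (\<Prod>v\<in>B. factor E (insert u T) v)
      \<le> 2 * (\<Prod>v\<in>B. factor (insert u E) T v)"
    and "\<lbrakk>v \<in> N u; T \<inter> M v = {}; y \<in> E \<inter> M v; deg y < deg u\<rbrakk> \<Longrightarrow>
      (\<Prod>v\<in>B. factor E T v) + (\<Prod>v\<in>B. factor E (insert u T) v)
      < 2 * (\<Prod>v\<in>B. factor (insert u E) T v)"
    and "\<lbrakk>v \<in> N u; T \<inter> M v = {}; v' \<in> N u; T \<inter> M v' \<noteq> {}\<rbrakk> \<Longrightarrow>
      (\<Prod>v\<in>B. factor E T v) + (\<Prod>v\<in>B. factor E (insert u T) v)
      < 2 * (\<Prod>v\<in>B. factor (insert u E) T v)"
proof -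
  define C where "C = (\<Prod>v\<in>B - N u. factor E T v)"
  define H where "H = (\<Prod>v\<in>N u. (factor E T v powr deg u + 1) powr (1 / deg u))"
  define K where "K = (\<Prod>v\<in>N u. factor (insert u E) T v)"
  define K' where "K' = (\<Prod>v\<in>N u. ((factor E T v powr deg u + 1) / 2) powr (1 / deg u))"
  have uE: "insert u E \<subseteq> A" using u E by auto
  have d: "deg u > 0" using u deg_ge_1[of u] by simp
  have split: "(\<Prod>v\<in>B. f v) = (\<Prod>v\<in>B - N u. f v) * (\<Prod>v\<in>N u. f v)" for f :: "'b \<Rightarrow> real"
    using prod.subset_diff[OF N_sub finite_B] .
  have C: "C > 0" unfolding C_def using factor_pos[OF E] by (intro prod_pos) auto
  have "(\<Prod>v\<in>N u. factor E (insert u T) v) = 1"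
    by (intro prod.neutral) (auto simp: factor_def)
  moreover have "(\<Prod>v\<in>B - N u. factor E (insert u T) v) = C"
    unfolding C_def by (intro prod.cong) (auto simp: factor_def)
  ultimately have lhs: "(\<Prod>v\<in>B. factor E T v) + (\<Prod>v\<in>B. factor E (insert u T) v)
      = C * ((\<Prod>v\<in>N u. factor E T v) + 1)"
    unfolding split by (simp add: C_def algebra_simps)
  have "(\<Prod>v\<in>B - N u. factor (insert u E) T v) = C"
    unfolding C_def by (intro prod.cong) (auto simp: factor_def)
  then have rhs: "2 * (\<Prod>v\<in>B. factor (insert u E) T v) = C * (2 * K)"
    unfolding split by (simp add: K_def)
  have H_eq: "H = 2 * K'"
  proof -
    have "H = (\<Prod>v\<in>N u. 2 powr (1 / deg u) * ((factor E T v powr deg u + 1) / 2) powr (1 / deg u))"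
      unfolding H_def by (intro prod.cong) (simp_all add: powr_divide)
    also have "\<dots> = (2 powr (1 / deg u)) ^ deg u * K'"
      by (simp add: prod.distrib K'_def)
    also have "(2 powr (1 / deg u)) ^ deg u = (2::real)"
      using d by (simp add: powr_realpow[symmetric] powr_powr)
    finally show ?thesis .
  qed
  have ne: "N u \<noteq> {}" using u no_isolated by simp
  have H: "(\<Prod>v\<in>N u. factor E T v) + 1 \<le> H"
    unfolding H_def by (rule hoelder_two_point(1)[OF finite_N ne factor_pos[OF E]])
  have K: "K' \<le> K"
    unfolding K_def K'_def using eliminate_factor(1)[OF u E max] by (intro prod_mono) auto
  show "(\<Prod>v\<in>B. factor E T v) + (\<Prod>v\<in>B. factor E (insert u T) v)
      \<le> 2 * (\<Prod>v\<in>B. factor (insert u E) T v)"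
    unfolding lhs rhs using C H K H_eq by (intro mult_left_mono) auto
  { assume *: "v \<in> N u" "T \<inter> M v = {}" "y \<in> E \<inter> M v" "deg y < deg u"
    have "K' < K"
      unfolding K_def K'_def
      using *(1) eliminate_factor(1)[OF u E max] eliminate_factor(2)[OF u E max *] finite_N factor_pos[OF uE]
      by (intro prod_mono_strict[of v]) auto
    then show "(\<Prod>v\<in>B. factor E T v) + (\<Prod>v\<in>B. factor E (insert u T) v)
        < 2 * (\<Prod>v\<in>B. factor (insert u E) T v)"
      unfolding lhs rhs using C H H_eq by (intro mult_strict_left_mono) auto }
  { assume *: "v \<in> N u" "T \<inter> M v = {}" "v' \<in> N u" "T \<inter> M v' \<noteq> {}"
    have "factor E T v \<noteq> factor E T v'"
      using * star_gt_1[OF E, of v] by (simp add: factor_def)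
    then have "(\<Prod>v\<in>N u. factor E T v) + 1 < H"
      unfolding H_def using *(1,3) by (intro hoelder_two_point(2)[OF finite_N ne factor_pos[OF E]])
    then show "(\<Prod>v\<in>B. factor E T v) + (\<Prod>v\<in>B. factor E (insert u T) v)
        < 2 * (\<Prod>v\<in>B. factor (insert u E) T v)"
      unfolding lhs rhs using C K H_eq by (intro mult_strict_left_mono) auto }
qed

text \<open>
  The strict cases come from the single terms \<open>T = {}\<close> and \<open>T = {u'}\<close>.
\<close>

lemma eliminate:
  assumes u: "u \<in> A - E" and E: "E \<subseteq> A" and max: "\<And>y. y \<in> E \<Longrightarrow> deg y \<le> deg u"
  shows "\<Phi> E \<le> \<Phi> (insert u E)"
    and "\<lbrakk>v \<in> N u; y \<in> E \<inter> M v; deg y < deg u\<rbrakk> \<Longrightarrow> \<Phi> E < \<Phi> (insert u E)"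
    and "\<lbrakk>u' \<in> A - insert u E; v \<in> N u; v \<notin> N u'; v' \<in> N u; v' \<in> N u'\<rbrakk> \<Longrightarrow> \<Phi> E < \<Phi> (insert u E)"
proof -
  define f where "f T = (\<Prod>v\<in>B. factor E T v) + (\<Prod>v\<in>B. factor E (insert u T) v)" for T
  define g where "g T = 2 * (\<Prod>v\<in>B. factor (insert u E) T v)" for T
  define C where "C = A - insert u E"
  have fC: "finite C" and uC: "u \<notin> C" and AE: "A - E = insert u C"
    using u finite_A by (auto simp: C_def)
  have lhs: "\<Phi> E = 2 ^ card E * (\<Sum>T\<in>Pow C. f T)"
    unfolding \<Phi>_def AE sum_Pow_insert[OF fC uC] f_def ..
  have "finite E" using E finite_A by (rule finite_subset)
  then have rhs: "\<Phi> (insert u E) = 2 ^ card E * (\<Sum>T\<in>Pow C. g T)"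
    using u unfolding \<Phi>_def g_def C_def by (simp add: sum_distrib_left mult_ac)
  have le: "f T \<le> g T" if "T \<in> Pow C" for T
    unfolding f_def g_def by (rule eliminate_term(1)[OF u E]) (rule max)
  then show "\<Phi> E \<le> \<Phi> (insert u E)"
    unfolding lhs rhs by (intro mult_left_mono sum_mono) auto
  have lt: "\<Phi> E < \<Phi> (insert u E)" if "T \<in> Pow C" "f T < g T" for T
    unfolding lhs rhs using that le fC
    by (intro mult_strict_left_mono sum_strict_mono_ex1) auto
  { assume "v \<in> N u" "y \<in> E \<inter> M v" "deg y < deg u"
    then have "f {} < g {}"
      unfolding f_def g_def by (intro eliminate_term(2)[OF u E max]) auto
    then show "\<Phi> E < \<Phi> (insert u E)" by (intro lt[of "{}"]) auto }
  { assume *: "u' \<in> A - insert u E" "v \<in> N u" "v \<notin> N u'" "v' \<in> N u" "v' \<in> N u'"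
    have block: "{u'} \<inter> M v = {}" "{u'} \<inter> M v' \<noteq> {}" using *(3,5) by auto
    have "f {u'} < g {u'}"
      unfolding f_def g_def by (rule eliminate_term(3)[OF u E _ *(2) block(1) *(4) block(2)]) (rule max)
    moreover have "{u'} \<in> Pow C" using *(1) by (simp add: C_def)
    ultimately show "\<Phi> E < \<Phi> (insert u E)" by (intro lt[of "{u'}"]) }
qed

text \<open>
  Elimination in order of increasing degree. Equality \<open>\<Phi> {} = \<Phi> E\<close> means that no step was strict.
  Then an eliminated vertex has the same degree as any other eliminated vertex with which it shares a
  neighbour. For two vertices with a common neighbour, the step that eliminates the first of them shows
  that its neighbourhood is contained in that of the other; since the order does not appear in the
  statement, the conclusion is only that one of the neighbourhoods contains the other.
\<close>

lemma \<Phi>_mono: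
  assumes "E \<subseteq> A"
  shows "\<Phi> {} \<le> \<Phi> E"
    and "\<Phi> {} = \<Phi> E \<Longrightarrow> \<forall>u\<in>E. \<forall>u'\<in>A. N u \<inter> N u' \<noteq> {} \<longrightarrow>
      (u' \<in> E \<longrightarrow> deg u = deg u') \<and> (N u \<subseteq> N u' \<or> N u' \<subseteq> N u)"
proof -
  have "finite E" using assms finite_A by (rule finite_subset)
  then have "E \<subseteq> A \<longrightarrow> \<Phi> {} \<le> \<Phi> E \<and> (\<Phi> {} = \<Phi> E \<longrightarrow> (\<forall>u\<in>E. \<forall>u'\<in>A. N u \<inter> N u' \<noteq> {} \<longrightarrow>
      (u' \<in> E \<longrightarrow> deg u = deg u') \<and> (N u \<subseteq> N u' \<or> N u' \<subseteq> N u)))"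
  proof (induction rule: finite_ranking_induct[where f = deg])
    case (insert u E)
    show ?case
    proof (cases "u \<in> E")
      case True
      then show ?thesis using insert.IH by (simp add: insert_absorb)
    next
      case False
      show ?thesis
      proof (intro impI)
        assume sub: "insert u E \<subseteq> A"
        then have u: "u \<in> A - E" and E: "E \<subseteq> A" using False by auto
        have max: "deg y \<le> deg u" if "y \<in> E" for y using insert.hyps(2)[OF that] .
        have step: "\<Phi> E \<le> \<Phi> (insert u E)" by (rule eliminate(1)[OF u E]) (rule max)
        have IH: "\<Phi> {} \<le> \<Phi> E"
          "\<Phi> {} = \<Phi> E \<Longrightarrow> y \<in> E \<Longrightarrow> y' \<in> A \<Longrightarrow> N y \<inter> N y' \<noteq> {} \<Longrightarrow>
            (y' \<in> E \<longrightarrow> deg y = deg y') \<and> (N y \<subseteq> N y' \<or> N y' \<subseteq> N y)" for y y'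
          using insert.IH E by blast+
        have nested: "(y' \<in> insert u E \<longrightarrow> deg y = deg y') \<and> (N y \<subseteq> N y' \<or> N y' \<subseteq> N y)"
          if eq: "\<Phi> {} = \<Phi> (insert u E)" and y: "y \<in> insert u E" "y' \<in> A" "N y \<inter> N y' \<noteq> {}" for y y'
        proof -
          have eqE: "\<Phi> {} = \<Phi> E" and nlt: "\<not> \<Phi> E < \<Phi> (insert u E)"
            using IH(1) step eq by auto
          have degu: "deg x = deg u" if x: "x \<in> E" "N x \<inter> N u \<noteq> {}" for x
          proof -
            obtain v where v: "v \<in> N u" "x \<in> E \<inter> M v" using x by blast
            have "\<Phi> E < \<Phi> (insert u E)" if "deg x < deg u"
              by (rule eliminate(2)[OF u E _ v that]) (rule max)
            then show ?thesis using nlt max[OF x(1)] by fastforce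
          qed
          consider "y \<in> E" "y' = u" | "y \<in> E" "y' \<noteq> u" | "y = u" "y' \<in> E" | "y = u" "y' = u"
            | "y = u" "y' \<in> A - insert u E" using y(1,2) by blast
          then show ?thesis
          proof cases
            case 1
            then show ?thesis using IH(2)[OF eqE 1(1) y(2,3)] degu[of y] y(3) by simp
          next
            case 2
            then show ?thesis using IH(2)[OF eqE 2(1) y(2,3)] by simp
          next
            case 3
            then have share: "N y' \<inter> N u \<noteq> {}" using y(3) by (simp add: Int_commute)
            have "u \<in> A" using u by simp
            then show ?thesis using IH(2)[OF eqE 3(2) _ share] degu[OF 3(2) share] 3(1) by auto
          next
            case 4
            then show ?thesis by simp
          next
            case 5
            obtain v' where v': "v' \<in> N u" "v' \<in> N y'" using 5(1) y(3) by blast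
            have "N u \<subseteq> N y'"
            proof (rule subsetI, rule ccontr)
              fix v assume v: "v \<in> N u" "v \<notin> N y'"
              have "\<Phi> E < \<Phi> (insert u E)"
                by (rule eliminate(3)[OF u E _ 5(2) v v']) (rule max)
              then show False using nlt by simp
            qed
            then show ?thesis using 5 by simp
          qed
        qed
        show "\<Phi> {} \<le> \<Phi> (insert u E) \<and> (\<Phi> {} = \<Phi> (insert u E) \<longrightarrow>
          (\<forall>y\<in>insert u E. \<forall>y'\<in>A. N y \<inter> N y' \<noteq> {} \<longrightarrow>
            (y' \<in> insert u E \<longrightarrow> deg y = deg y') \<and> (N y \<subseteq> N y' \<or> N y' \<subseteq> N y)))"
          using order_trans[OF IH(1) step] nested by (intro conjI[OF _ impI] ballI impI) (assumption | rule)+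
      qed
    qed
  qed simp
  then show "\<Phi> {} \<le> \<Phi> E"
    and "\<Phi> {} = \<Phi> E \<Longrightarrow> \<forall>u\<in>E. \<forall>u'\<in>A. N u \<inter> N u' \<noteq> {} \<longrightarrow>
      (u' \<in> E \<longrightarrow> deg u = deg u') \<and> (N u \<subseteq> N u' \<or> N u' \<subseteq> N u)"
    using assms by blast+
qed

definition indep_pairs :: "('a set \<times> 'b set) set" where
  "indep_pairs = {(S, T). S \<subseteq> A \<and> T \<subseteq> B \<and> S \<times> T \<inter> R = {}}"

lemma \<Phi>_empty: "\<Phi> {} = card indep_pairs"
proof -
  have "indep_pairs = Sigma (Pow A) (\<lambda>S. Pow {v\<in>B. S \<inter> M v = {}})"
    unfolding indep_pairs_def by auto
  then have "real (card indep_pairs) = (\<Sum>S\<in>Pow A. 2 ^ card {v\<in>B. S \<inter> M v = {}})"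
    using finite_A finite_B by (simp add: card_SigmaI card_Pow)
  also have "\<dots> = (\<Sum>S\<in>Pow A. \<Prod>v\<in>B. factor {} S v)"
  proof (rule sum.cong)
    fix S
    show "2 ^ card {v\<in>B. S \<inter> M v = {}} = (\<Prod>v\<in>B. factor {} S v)"
      using finite_B by (simp add: factor_def star_norm_def prod.If_cases Int_def)
  qed simp
  finally show ?thesis by (simp add: \<Phi>_def)
qed

text \<open>
  The normalisation of \<open>biclique_ratio\<close> contributes \<open>2 powr - (1 / deg u)\<close> for every edge at \<open>u\<close>, hence
  \<open>1 / 2\<close> for every \<open>u \<in> A\<close>. This cancels the power of two in \<open>\<Phi> A\<close>.
\<close>

lemma \<Phi>_full:
  assumes no_isolated': "\<And>v. v \<in> B \<Longrightarrow> M v \<noteq> {}"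
  shows "\<Phi> A = (\<Prod>(u, v)\<in>R. (2 ^ deg u + 2 ^ card (M v) - 1) powr (1 / (real (deg u) * real (card (M v)))))"
proof -
  define h where "h u v = (2 ^ deg u + 2 ^ card (M v) - 1 :: real) powr (1 / (real (deg u) * real (card (M v))))" for u v
  have R_eq: "R = Sigma A N" and R_eq': "R\<inverse> = Sigma B M" using R_sub by auto
  have fM: "finite (M v)" for v using M_sub finite_A by (rule finite_subset)
  have swap: "(\<Prod>v\<in>B. \<Prod>u\<in>M v. f u v) = (\<Prod>(u, v)\<in>R. f u v)" for f :: "'a \<Rightarrow> 'b \<Rightarrow> real"
  proof -
    have "(\<Prod>v\<in>B. \<Prod>u\<in>M v. f u v) = (\<Prod>(v, u)\<in>R\<inverse>. f u v)"
      using prod.Sigma[of B M "\<lambda>v u. f u v"] finite_B fM R_eq' by simp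
    also have "\<dots> = (\<Prod>(u, v)\<in>R. f u v)"
      by (rule prod.reindex_bij_witness[of _ prod.swap prod.swap]) auto
    finally show ?thesis .
  qed
  have star: "star_norm deg (M v) = (\<Prod>u\<in>M v. h u v * 2 powr - (1 / deg u))" if v: "v \<in> B" for v
  proof -
    define k where "k = card (M v)"
    have k: "k > 0" using no_isolated'[OF v] fM by (simp add: k_def card_gt_0_iff)
    have "biclique_ratio (2 ^ deg u) k powr (1 / (real k * real (deg u))) = h u v * 2 powr - (1 / deg u)" for u
    proof -
      have "biclique_ratio (2 ^ deg u) k = (2 ^ deg u + 2 ^ k - 1) / 2 ^ k"
        by (simp add: biclique_ratio_def field_simps)
      moreover have "(2 ^ k) powr (1 / (real k * real (deg u))) = (2 powr (1 / deg u) :: real)"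
        using k by (simp add: powr_realpow[symmetric] powr_powr)
      moreover have "(2 ^ deg u + 2 ^ k - 1 :: real) \<ge> 0"
        by (smt (verit) one_le_power)
      ultimately show ?thesis
        by (simp add: h_def k_def powr_divide powr_minus_divide mult.commute)
    qed
    then show ?thesis using no_isolated'[OF v] by (simp add: star_norm_def k_def)
  qed
  have "(\<Prod>v\<in>B. star_norm deg (M v)) = (\<Prod>(u, v)\<in>R. h u v * 2 powr - (1 / deg u))"
    unfolding swap[symmetric] using star by (intro prod.cong) auto
  also have "\<dots> = (\<Prod>(u, v)\<in>R. h u v) * (\<Prod>(u, v)\<in>R. 2 powr - (1 / deg u))"
    by (simp add: prod.distrib[symmetric] case_prod_unfold)
  also have "(\<Prod>(u, v)\<in>R. 2 powr - (1 / deg u)) = (\<Prod>u\<in>A. \<Prod>v\<in>N u. 2 powr - (1 / deg u) :: real)"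
    using prod.Sigma[of A N "\<lambda>u v. 2 powr - (1 / deg u) :: real"] finite_A finite_N R_eq by simp
  also have "\<dots> = (\<Prod>u\<in>A. 1 / 2)"
  proof (rule prod.cong)
    fix u assume "u \<in> A"
    then show "(\<Prod>v\<in>N u. 2 powr - (1 / deg u)) = (1 / 2 :: real)"
      using deg_ge_1[of u] by (simp add: powr_realpow[symmetric] powr_powr)
  qed simp
  finally have "2 ^ card A * (\<Prod>v\<in>B. star_norm deg (M v)) = (\<Prod>(u, v)\<in>R. h u v)"
    by (simp add: power_one_over)
  moreover have "A \<inter> M v = M v" for v using M_sub by auto
  ultimately show ?thesis unfolding \<Phi>_def factor_def h_def by simp
qed

theorem card_indep_pairs:
  assumes "\<And>v. v \<in> B \<Longrightarrow> M v \<noteq> {}"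
  shows "card indep_pairs
      \<le> (\<Prod>(u, v)\<in>R. (2 ^ deg u + 2 ^ card (M v) - 1) powr (1 / (real (deg u) * real (card (M v)))))"
      (is "_ \<le> ?bound")
    and "\<lbrakk>card indep_pairs
        = (\<Prod>(u, v)\<in>R. (2 ^ deg u + 2 ^ card (M v) - 1) powr (1 / (real (deg u) * real (card (M v)))));
      u \<in> A; u' \<in> A; N u \<inter> N u' \<noteq> {}\<rbrakk> \<Longrightarrow> N u = N u'"
proof -
  have ends: "\<Phi> {} = card indep_pairs" "\<Phi> A = ?bound"
    using \<Phi>_empty \<Phi>_full[OF assms] by simp_all
  show "card indep_pairs \<le> ?bound"
    using \<Phi>_mono(1)[of A] unfolding ends by simp
  assume eq: "card indep_pairs = ?bound" and u: "u \<in> A" "u' \<in> A" "N u \<inter> N u' \<noteq> {}"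
  have "\<Phi> {} = \<Phi> A" unfolding ends eq ..
  then have "deg u = deg u' \<and> (N u \<subseteq> N u' \<or> N u' \<subseteq> N u)"
    using \<Phi>_mono(2)[of A] u by blast
  then show "N u = N u'" using finite_N by (metis card_subset_eq)
qed

end

section \<open>The bipartite double cover\<close>

abbreviation nbhd :: "'a pair_pre_digraph \<Rightarrow> 'a \<Rightarrow> 'a set" where
  "nbhd G v \<equiv> parcs G `` {v}"

lemma vdegree_eq_card_nbhd: "vdegree G v = card (nbhd G v)"
proof -
  have "{e \<in> parcs G. fst e = v} = Pair v ` nbhd G v" by auto
  then show ?thesis by (simp add: out_degree_def out_arcs_def card_image inj_on_def)
qed

lemma insert_in_edges_iff:
  assumes "sym (parcs G)"
  shows "{u, v} \<in> edges G \<longleftrightarrow> (u, v) \<in> parcs G"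
  using assms by (auto simp: edges_def doubleton_eq_iff dest: symD)

definition indep_sets :: "'a pair_pre_digraph \<Rightarrow> 'a set set" where
  "indep_sets G = {S. S \<subseteq> pverts G \<and> indep S (edges G)}"

lemma num_indep_eq: "num_indep G = card (indep_sets G)"
  by (simp add: num_indep_def indep_sets_def)

lemma pair_graph_simps:
  assumes "pair_graph G"
  shows "sym (parcs G)" "(v, v) \<notin> parcs G" "parcs G \<subseteq> pverts G \<times> pverts G"
    "finite (pverts G)" "finite (parcs G)"
proof -
  interpret pair_graph G by fact
  show "sym (parcs G)" using pair_sym_arcs by (simp add: symmetric_def)
  show "(v, v) \<notin> parcs G" using pair_no_loops[of "(v, v)"] by auto
  show "parcs G \<subseteq> pverts G \<times> pverts G" by (auto dest: arc_fst_in_verts arc_snd_in_verts)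
  show "finite (pverts G)" "finite (parcs G)" using pair_finite_verts pair_finite_arcs .
qed

lemma mem_indep_sets_iff:
  assumes "pair_graph G"
  shows "S \<in> indep_sets G \<longleftrightarrow> S \<subseteq> pverts G \<and> S \<times> S \<inter> parcs G = {}"
proof -
  have "indep S (edges G) \<longleftrightarrow> (\<forall>u\<in>S. \<forall>v\<in>S. (u, v) \<notin> parcs G)"
    unfolding indep_def insert_in_edges_iff[OF pair_graph_simps(1)[OF assms]]
    using pair_graph_simps(2)[OF assms] by metis
  then show ?thesis unfolding indep_sets_def by auto
qed

definition two_colouring :: "'a pair_pre_digraph \<Rightarrow> 'a set \<Rightarrow> 'a set \<Rightarrow> bool" where
  "two_colouring G U W \<longleftrightarrow> (\<forall>u\<in>U. \<forall>v\<in>U. (u, v) \<in> parcs G \<longrightarrow> (u \<in> W \<longleftrightarrow> v \<notin> W))"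

text \<open>
  Zhao's bipartite swapping. For independent sets \<open>S\<close>, \<open>T\<close> of \<open>G\<close> every edge inside \<open>S \<union> T\<close> runs between
  \<open>S\<close> and \<open>T\<close>, so \<open>S \<union> T\<close> has a proper 2-colouring. Exchange the roles of \<open>S\<close> and \<open>T\<close> on one colour class \<open>W\<close>.
  An edge between the new sets would lie inside \<open>S \<union> T\<close>, so exactly one of its ends lies in \<open>W\<close>,
  and then both ends belong to \<open>S\<close> or both to \<open>T\<close>, which is impossible. The
  class \<open>W\<close> is chosen as a function of \<open>S \<union> T\<close> alone. The exchange does not change the union, so it is its
  own inverse, and in particular injective.
\<close>

lemma num_indep_square_le:
  assumes G: "pair_graph G"
  shows "num_indep G ^ 2 \<le> card {(S, T). S \<subseteq> pverts G \<and> T \<subseteq> pverts G \<and> S \<times> T \<inter> parcs G = {}}"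
    (is "_ \<le> card ?P")
proof -
  define c where "c U = (SOME W. two_colouring G U W)" for U
  define sw where "sw = (\<lambda>(S, T). let W = c (S \<union> T) in ((S - W) \<union> (T \<inter> W), (T - W) \<union> (S \<inter> W)))"
  note G' = pair_graph_simps[OF G]
  have col: "two_colouring G (S \<union> T) (c (S \<union> T))" if "S \<in> indep_sets G" "T \<in> indep_sets G" for S T
  proof -
    have "two_colouring G (S \<union> T) S"
      using that G'(1) unfolding mem_indep_sets_iff[OF G] two_colouring_def by (blast dest: symD)
    then show ?thesis unfolding c_def by (rule someI)
  qed
  have "inj_on sw (indep_sets G \<times> indep_sets G)"
  proof (rule inj_on_inverseI)
    fix p assume "p \<in> indep_sets G \<times> indep_sets G"
    obtain S T where p: "p = (S, T)" by fastforce
    define W where "W = c (S \<union> T)"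
    have sw: "sw p = ((S - W) \<union> (T \<inter> W), (T - W) \<union> (S \<inter> W))"
      by (simp add: sw_def p W_def Let_def)
    have "(S - W) \<union> (T \<inter> W) \<union> ((T - W) \<union> (S \<inter> W)) = S \<union> T" by blast
    then show "sw (sw p) = p"
      unfolding sw unfolding sw_def split Let_def p W_def[symmetric] by (auto simp: W_def[symmetric])
  qed
  moreover have "sw ` (indep_sets G \<times> indep_sets G) \<subseteq> ?P"
  proof (rule image_subsetI)
    fix p assume p: "p \<in> indep_sets G \<times> indep_sets G"
    obtain S T where p_eq: "p = (S, T)" by fastforce
    then have ST: "S \<in> indep_sets G" "T \<in> indep_sets G" using p by auto
    define W where "W = c (S \<union> T)"
    define S' where "S' = (S - W) \<union> (T \<inter> W)"
    define T' where "T' = (T - W) \<union> (S \<inter> W)"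
    have sw: "sw p = (S', T')" by (simp add: sw_def p_eq W_def S'_def T'_def Let_def)
    have W: "(u \<in> W) = (v \<notin> W)" if "(u, v) \<in> parcs G" "u \<in> S \<union> T" "v \<in> S \<union> T" for u v
      using col[OF ST] that unfolding two_colouring_def W_def by blast
    have "(u, v) \<notin> parcs G" if "u \<in> S'" "v \<in> T'" for u v
      using that W[of u v] ST unfolding S'_def T'_def mem_indep_sets_iff[OF G] by blast
    then have "S' \<times> T' \<inter> parcs G = {}" by blast
    moreover have "S' \<subseteq> pverts G" "T' \<subseteq> pverts G"
      using ST unfolding mem_indep_sets_iff[OF G] S'_def T'_def by blast+
    ultimately show "sw p \<in> ?P" by (simp add: sw)
  qed
  moreover have "finite ?P"
    by (rule finite_subset[of _ "Pow (pverts G) \<times> Pow (pverts G)"]) (use G'(4) in auto)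
  ultimately have "card (indep_sets G \<times> indep_sets G) \<le> card ?P"
    by (rule card_inj_on_le)
  then show ?thesis by (simp add: num_indep_eq card_cartesian_product power2_eq_square)
qed

lemma edge_prod_square:
  assumes G: "pair_graph G" and f: "\<And>u v. f u v = f v u"
  shows "edge_prod G f ^ 2 = (\<Prod>(u, v)\<in>parcs G. f u v)"
proof -
  note G' = pair_graph_simps[OF G]
  define g where "g e = (THE x. \<exists>u v. e = {u, v} \<and> x = f u v)" for e
  define E where "E p = {fst p, snd p}" for p :: "'a \<times> 'a"
  have E: "edges G = E ` parcs G" unfolding edges_def E_def image_def Bex_def by auto
  have "(\<Prod>p\<in>parcs G. f (fst p) (snd p)) = (\<Prod>e\<in>edges G. \<Prod>p\<in>{p\<in>parcs G. E p = e}. f (fst p) (snd p))"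
    using G'(5) by (intro prod.group[symmetric]) (simp_all add: E)
  also have "\<dots> = (\<Prod>e\<in>edges G. g e ^ 2)"
  proof (rule prod.cong)
    fix e assume "e \<in> edges G"
    then obtain u v where e: "e = {u, v}" and uv: "(u, v) \<in> parcs G" by (auto simp: edges_def)
    have ne: "u \<noteq> v" using uv G'(2) by auto
    have "{p\<in>parcs G. E p = e} = {(u, v), (v, u)}"
      using uv symD[OF G'(1) uv] by (auto simp: E_def e doubleton_eq_iff)
    then show "(\<Prod>p\<in>{p\<in>parcs G. E p = e}. f (fst p) (snd p)) = g e ^ 2"
      using ne f[of v u] edge_value[of f u v, OF f] by (simp add: g_def e power2_eq_square)
  qed simp
  finally show ?thesis
    unfolding edge_prod_def g_def by (simp add: prod_power_distrib case_prod_unfold)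
qed

section \<open>Disjoint unions of complete bipartite graphs\<close>

lemma num_indep_bipartition:
  assumes "finite X" "finite Y" "X \<inter> Y = {}"
    and H: "pverts H = X \<union> Y" "parcs H = X \<times> Y \<union> Y \<times> X"
  shows "real (num_indep H) = 2 ^ card X + 2 ^ card Y - 1"
proof -
  have "sym (parcs H)" unfolding sym_def H by blast
  then have indep_iff: "indep S (edges H) \<longleftrightarrow> (\<forall>u\<in>S. \<forall>v\<in>S. u \<noteq> v \<longrightarrow> (u, v) \<notin> parcs H)" for S
    by (simp add: indep_def insert_in_edges_iff)
  have "indep_sets H = Pow X \<union> Pow Y"
  proof
    show "indep_sets H \<subseteq> Pow X \<union> Pow Y"
    proof (rule subsetI, rule ccontr)
      fix S assume S: "S \<in> indep_sets H" and "S \<notin> Pow X \<union> Pow Y"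
      then have "\<not> S \<subseteq> X" "\<not> S \<subseteq> Y" by simp_all
      then obtain u v where uv: "u \<in> S" "u \<notin> Y" "v \<in> S" "v \<notin> X" by (meson subsetI)
      have sub: "S \<subseteq> X \<union> Y" and ind: "indep S (edges H)"
        using S by (simp_all add: indep_sets_def H)
      have XY: "u \<in> X" "v \<in> Y" using sub uv by blast+
      moreover have "(u, v) \<notin> parcs H"
        using ind uv XY unfolding indep_iff by metis
      ultimately show False by (simp add: H)
    qed
    show "Pow X \<union> Pow Y \<subseteq> indep_sets H"
    proof
      fix S assume S: "S \<in> Pow X \<union> Pow Y"
      then have "S \<subseteq> pverts H" by (auto simp: H)
      moreover have "(u, v) \<notin> parcs H" if "u \<in> S" "v \<in> S" for u v
        using S that assms(3) unfolding H by blast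
      ultimately show "S \<in> indep_sets H" by (simp add: indep_sets_def indep_iff)
    qed
  qed
  moreover have "Pow X \<inter> Pow Y = {{}}" using assms(3) by auto
  ultimately have "num_indep H + 1 = 2 ^ card X + 2 ^ card Y"
    using card_Un_Int[of "Pow X" "Pow Y"] assms(1,2) by (simp add: num_indep_eq card_Pow)
  then have "real (num_indep H + 1) = real (2 ^ card X + 2 ^ card Y)" by simp
  then show ?thesis by simp
qed

lemma num_indep_complete_bipartite: "real (num_indep (complete_bipartite a b)) = 2 ^ a + 2 ^ b - 1"
proof -
  have "real (num_indep (complete_bipartite a b))
      = 2 ^ card (Inl ` {..<a} :: (nat + nat) set) + 2 ^ card (Inr ` {..<b} :: (nat + nat) set) - 1"
    by (rule num_indep_bipartition) (auto simp: complete_bipartite_def)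
  then show ?thesis by (simp add: card_image)
qed

text \<open>
  The component of an edge \<open>uv\<close> is complete bipartite with parts \<open>N u\<close> and \<open>N v\<close>: all vertices of \<open>N v\<close>
  share the neighbour \<open>v\<close>, so they have the same neighbourhood as \<open>u\<close>, and symmetrically.
  The parts are disjoint, because a common vertex would be its own neighbour.
\<close>

lemma disjoint_union_complete_bipartiteI:
  assumes G: "pair_graph G" and no_isolated: "\<And>v. v \<in> pverts G \<Longrightarrow> nbhd G v \<noteq> {}"
    and twins: "\<And>u u'. nbhd G u \<inter> nbhd G u' \<noteq> {} \<Longrightarrow> nbhd G u = nbhd G u'"
  shows "disjoint_union_complete_bipartite G"
proof -
  note G' = pair_graph_simps[OF G]
  define K where "K u v = \<lparr>pverts = nbhd G u \<union> nbhd G v,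
    parcs = nbhd G u \<times> nbhd G v \<union> nbhd G v \<times> nbhd G u\<rparr>" for u v
  define \<H> where "\<H> = (\<lambda>(u, v). K u v) ` parcs G"
  have K_in: "K u v \<in> \<H>" if "(u, v) \<in> parcs G" for u v
    unfolding \<H>_def by (rule rev_image_eqI[OF that]) simp
  have K_commute: "K u v = K v u" for u v by (simp add: K_def Un_commute)
  have rev: "(v, u) \<in> parcs G" if "(u, v) \<in> parcs G" for u v
    by (rule symD[OF G'(1) that])
  have arc: "v \<in> nbhd G u" "u \<in> nbhd G v" if "(u, v) \<in> parcs G" for u v
    using that rev[OF that] by simp_all
  have same: "nbhd G x = nbhd G u" if "u \<in> nbhd G v" "x \<in> nbhd G v" for u v x
  proof -
    have "v \<in> nbhd G x \<inter> nbhd G u" using that rev[of v x] rev[of v u] by simp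
    then show ?thesis by (intro twins) blast
  qed
  have comp: "K u v = K x y"
    if uv: "(u, v) \<in> parcs G" and x: "x \<in> pverts (K u v)" and xy: "(x, y) \<in> parcs G" for u v x y
  proof -
    have *: "K u v = K x y" if uv: "(u, v) \<in> parcs G" and x: "x \<in> nbhd G v" for u v
    proof -
      have xu: "nbhd G x = nbhd G u" using arc(2)[OF uv] x by (rule same)
      have "y \<in> nbhd G u" using arc(1)[OF xy] unfolding xu .
      then have "nbhd G y = nbhd G v" by (rule same[OF arc(1)[OF uv]])
      with xu show ?thesis by (simp only: K_def)
    qed
    have "x \<in> nbhd G u \<or> x \<in> nbhd G v" using x by (simp add: K_def)
    then show ?thesis using *[OF uv] *[OF rev[OF uv]] K_commute[of u v] by metis
  qed
  have "disjoint_family_on pverts \<H>"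
  proof (unfold disjoint_family_on_def, intro ballI impI)
    fix H H' assume H: "H \<in> \<H>" "H' \<in> \<H>" "H \<noteq> H'"
    show "pverts H \<inter> pverts H' = {}"
    proof (rule ccontr)
      assume "pverts H \<inter> pverts H' \<noteq> {}"
      then obtain x where x: "x \<in> pverts H" "x \<in> pverts H'" by auto
      obtain u v u' v' where uv: "H = K u v" "(u, v) \<in> parcs G" "H' = K u' v'" "(u', v') \<in> parcs G"
        using H unfolding \<H>_def by auto
      have "(u, x) \<in> parcs G \<or> (v, x) \<in> parcs G" using x(1) by (simp add: uv(1) K_def)
      then obtain y where "(y, x) \<in> parcs G" by blast
      then have xy: "(x, y) \<in> parcs G" by (rule rev)
      have "H = K x y" using comp[OF uv(2) _ xy] x(1) uv(1) by metis
      moreover have "H' = K x y" using comp[OF uv(4) _ xy] x(2) uv(3) by metis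
      ultimately show False using H(3) by simp
    qed
  qed
  moreover have "pverts G = (\<Union>H\<in>\<H>. pverts H)"
  proof
    show "pverts G \<subseteq> (\<Union>H\<in>\<H>. pverts H)"
    proof
      fix v assume "v \<in> pverts G"
      then obtain w where "(v, w) \<in> parcs G" using no_isolated by blast
      moreover from this have "v \<in> pverts (K v w)" using arc(2) by (simp add: K_def)
      ultimately show "v \<in> (\<Union>H\<in>\<H>. pverts H)" using K_in by blast
    qed
    have "nbhd G u \<subseteq> pverts G" for u using G'(3) by blast
    then show "(\<Union>H\<in>\<H>. pverts H) \<subseteq> pverts G" by (fastforce simp: \<H>_def K_def)
  qed
  moreover have "parcs G = (\<Union>H\<in>\<H>. parcs H)"
  proof
    show "parcs G \<subseteq> (\<Union>H\<in>\<H>. parcs H)"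
    proof
      fix p assume p: "p \<in> parcs G"
      obtain u v where uv: "p = (u, v)" by fastforce
      have "p \<in> parcs (K u v)" using p arc[of u v] by (simp add: uv K_def)
      then show "p \<in> (\<Union>H\<in>\<H>. parcs H)" using K_in p uv by blast
    qed
    show "(\<Union>H\<in>\<H>. parcs H) \<subseteq> parcs G"
    proof (rule UN_least, rule subrelI)
      fix H x y assume "H \<in> \<H>" and xy: "(x, y) \<in> parcs H"
      then obtain u v where uv: "(u, v) \<in> parcs G" and H: "H = K u v" by (auto simp: \<H>_def)
      consider "x \<in> nbhd G u" "y \<in> nbhd G v" | "x \<in> nbhd G v" "y \<in> nbhd G u"
        using xy by (auto simp: H K_def)
      then have "y \<in> nbhd G x"
      proof cases
        case 1
        then show ?thesis using same[OF arc(1)[OF uv] 1(1)] by (simp only:)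
      next
        case 2
        then show ?thesis using same[OF arc(2)[OF uv] 2(1)] by (simp only:)
      qed
      then show "(x, y) \<in> parcs G" by simp
    qed
  qed
  moreover have "\<exists>a\<ge>1. \<exists>b\<ge>1. complete_bipartite_digraph a b (with_proj H)" if H_in: "H \<in> \<H>" for H
  proof -
    obtain u v where uv: "(u, v) \<in> parcs G" and H: "H = K u v" using H_in by (auto simp: \<H>_def)
    have fin: "finite (nbhd G x)" for x
      using G'(5) by (rule finite_Image)
    have "nbhd G u \<inter> nbhd G v = {}"
    proof (rule ccontr)
      assume "nbhd G u \<inter> nbhd G v \<noteq> {}"
      then obtain x where x: "x \<in> nbhd G u" "x \<in> nbhd G v" by auto
      have "x \<in> nbhd G x" using x(1) unfolding same[OF arc(2)[OF uv] x(2)] .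
      then show False using G'(2) by simp
    qed
    then have "complete_bipartite_digraph (card (nbhd G u)) (card (nbhd G v)) (with_proj H)"
      unfolding complete_bipartite_digraph_pair_def H
      by (intro conjI exI[of _ "nbhd G u"] exI[of _ "nbhd G v"]) (simp_all add: K_def fin)
    moreover have "card (nbhd G u) \<ge> 1" "card (nbhd G v) \<ge> 1"
      using arc[OF uv] fin by (simp_all add: Suc_le_eq card_gt_0_iff) blast+
    ultimately show ?thesis by blast
  qed
  ultimately show ?thesis
    unfolding disjoint_union_complete_bipartite_def disjoint_union_of_def by blast
qed

lemma num_indep_disjoint_union:
  assumes fin: "finite \<H>" and union: "disjoint_union_of \<H> G" and graphs: "\<And>H. H \<in> \<H> \<Longrightarrow> pair_graph H"
    and G: "pair_graph G"
  shows "num_indep G = (\<Prod>H\<in>\<H>. num_indep H)"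
proof -
  have V: "pverts G = (\<Union>H\<in>\<H>. pverts H)" and E: "parcs G = (\<Union>H\<in>\<H>. parcs H)"
    and disj: "\<And>H H'. H \<in> \<H> \<Longrightarrow> H' \<in> \<H> \<Longrightarrow> H \<noteq> H' \<Longrightarrow> pverts H \<inter> pverts H' = {}"
    using union by (auto simp: disjoint_union_of_def disjoint_family_on_def)
  have arcs: "parcs H \<subseteq> pverts H \<times> pverts H" if "H \<in> \<H>" for H
    using pair_graph_simps(3)[OF graphs[OF that]] .
  have part: "(\<Union>H'\<in>\<H>. F H') \<inter> pverts H = F H"
    if "H \<in> \<H>" "\<And>H. H \<in> \<H> \<Longrightarrow> F H \<subseteq> pverts H" for F H
    using that disj by fastforce
  have "bij_betw (\<lambda>S. \<lambda>H\<in>\<H>. S \<inter> pverts H) (indep_sets G) (Pi\<^sub>E \<H> indep_sets)"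
  proof (rule bij_betw_byWitness[where f' = "\<lambda>F. \<Union>H\<in>\<H>. F H"])
    show "\<forall>S\<in>indep_sets G. (\<Union>H\<in>\<H>. (\<lambda>H\<in>\<H>. S \<inter> pverts H) H) = S"
      by (auto simp: indep_sets_def V)
    show "\<forall>F\<in>Pi\<^sub>E \<H> indep_sets. (\<lambda>H\<in>\<H>. (\<Union>H'\<in>\<H>. F H') \<inter> pverts H) = F"
    proof
      fix F assume F: "F \<in> Pi\<^sub>E \<H> indep_sets"
      then have "F H \<subseteq> pverts H" if "H \<in> \<H>" for H using that by (auto simp: indep_sets_def PiE_def Pi_def)
      then have "(\<Union>H'\<in>\<H>. F H') \<inter> pverts H = F H" if "H \<in> \<H>" for H using part[of H F] that by blast
      then show "(\<lambda>H\<in>\<H>. (\<Union>H'\<in>\<H>. F H') \<inter> pverts H) = F"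
        using F by (auto simp: fun_eq_iff PiE_def extensional_def)
    qed
    show "(\<lambda>S. \<lambda>H\<in>\<H>. S \<inter> pverts H) ` indep_sets G \<subseteq> Pi\<^sub>E \<H> indep_sets"
    proof (intro image_subsetI PiE_I)
      fix S H assume S: "S \<in> indep_sets G" and H: "H \<in> \<H>"
      then show "(\<lambda>H\<in>\<H>. S \<inter> pverts H) H \<in> indep_sets H"
        unfolding mem_indep_sets_iff[OF G] mem_indep_sets_iff[OF graphs[OF H]] E by auto
    qed simp
    show "(\<lambda>F. \<Union>H\<in>\<H>. F H) ` Pi\<^sub>E \<H> indep_sets \<subseteq> indep_sets G"
    proof (rule image_subsetI)
      fix F assume F: "F \<in> Pi\<^sub>E \<H> indep_sets"
      have FH: "F H \<subseteq> pverts H" "F H \<times> F H \<inter> parcs H = {}" if "H \<in> \<H>" for H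
        using F that mem_indep_sets_iff[OF graphs[OF that]] by (auto simp: PiE_def Pi_def)
      have "(u, v) \<notin> parcs H" if "u \<in> (\<Union>H\<in>\<H>. F H)" "v \<in> (\<Union>H\<in>\<H>. F H)" "H \<in> \<H>" for u v H
        using part[OF that(3) FH(1)] FH(2)[OF that(3)] arcs[OF that(3)] that(1,2) by blast
      then show "(\<Union>H\<in>\<H>. F H) \<in> indep_sets G"
        unfolding mem_indep_sets_iff[OF G] V E using FH(1) by blast
    qed
  qed
  then have "card (indep_sets G) = card (Pi\<^sub>E \<H> indep_sets)" by (rule bij_betw_same_card)
  then show ?thesis using fin by (simp add: num_indep_eq card_PiE)
qed

lemma edge_prod_disjoint_union:
  assumes fin: "finite \<H>" and union: "disjoint_union_of \<H> G" and graphs: "\<And>H. H \<in> \<H> \<Longrightarrow> pair_graph H"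
  shows "edge_prod G f = (\<Prod>H\<in>\<H>. edge_prod H f)"
proof -
  have E: "edges G = (\<Union>H\<in>\<H>. edges H)"
  proof -
    have "parcs G = (\<Union>H\<in>\<H>. parcs H)" using union by (simp add: disjoint_union_of_def)
    then show ?thesis unfolding edges_def by blast
  qed
  have disj: "\<And>H H'. H \<in> \<H> \<Longrightarrow> H' \<in> \<H> \<Longrightarrow> H \<noteq> H' \<Longrightarrow> pverts H \<inter> pverts H' = {}"
    using union by (auto simp: disjoint_union_of_def disjoint_family_on_def)
  have sub: "e \<subseteq> pverts H" "e \<noteq> {}" if "H \<in> \<H>" "e \<in> edges H" for e H
    using pair_graph_simps(3)[OF graphs[OF that(1)]] that(2) by (auto simp: edges_def)
  have "finite (edges H)" if "H \<in> \<H>" for H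
  proof -
    have "edges H \<subseteq> Pow (pverts H)" using sub[OF that] by auto
    then show ?thesis using pair_graph_simps(4)[OF graphs[OF that]] by (simp add: finite_subset)
  qed
  moreover have "edges H \<inter> edges H' = {}" if "H \<in> \<H>" "H' \<in> \<H>" "H \<noteq> H'" for H H'
  proof (rule ccontr)
    assume "edges H \<inter> edges H' \<noteq> {}"
    then obtain e where e: "e \<in> edges H" "e \<in> edges H'" by blast
    have "e \<subseteq> pverts H \<inter> pverts H'" using sub(1)[OF that(1) e(1)] sub(1)[OF that(2) e(2)] by simp
    then show False using disj[OF that] sub(2)[OF that(1) e(1)] by simp
  qed
  ultimately show ?thesis
    unfolding edge_prod_def E using fin by (intro prod.UNION_disjoint) auto
qed

lemma edge_prod_bipartition:
  assumes "finite X" "finite Y" "X \<inter> Y = {}" "X \<noteq> {}" "Y \<noteq> {}" and H: "parcs H = X \<times> Y \<union> Y \<times> X"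
    and f: "\<And>u v. u \<in> X \<Longrightarrow> v \<in> Y \<Longrightarrow> f u v = c powr (1 / (real (card X) * real (card Y)))"
    and sym: "\<And>u v. f u v = f v u" and c: "c > 0"
  shows "edge_prod H f = c"
proof -
  have E: "edges H = (\<lambda>(u, v). {u, v}) ` (X \<times> Y)"
  proof
    show "edges H \<subseteq> (\<lambda>(u, v). {u, v}) ` (X \<times> Y)"
    proof
      fix e assume "e \<in> edges H"
      then obtain u v where e: "e = {u, v}" "e = {v, u}" and "(u, v) \<in> X \<times> Y \<or> (v, u) \<in> X \<times> Y"
        by (auto simp: edges_def H)
      then show "e \<in> (\<lambda>(u, v). {u, v}) ` (X \<times> Y)"
        using rev_image_eqI[of "(u, v)" "X \<times> Y" e] rev_image_eqI[of "(v, u)" "X \<times> Y" e] by auto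
    qed
    show "(\<lambda>(u, v). {u, v}) ` (X \<times> Y) \<subseteq> edges H"
    proof (rule image_subsetI)
      fix p assume "p \<in> X \<times> Y"
      then obtain u v where p: "p = (u, v)" and "(u, v) \<in> parcs H" by (auto simp: H)
      then show "(case p of (u, v) \<Rightarrow> {u, v}) \<in> edges H"
        unfolding edges_def p split by blast
    qed
  qed
  have "inj_on (\<lambda>(u, v). {u, v}) (X \<times> Y)"
    using assms(3) by (auto simp: inj_on_def doubleton_eq_iff)
  then have card: "card (edges H) = card X * card Y"
    unfolding E by (simp add: card_image card_cartesian_product)
  have "edge_prod H f = (\<Prod>e\<in>edges H. c powr (1 / (real (card X) * real (card Y))))"
    unfolding edge_prod_def
  proof (rule prod.cong)
    fix e assume "e \<in> edges H"
    then obtain u v where "e = {u, v}" "u \<in> X" "v \<in> Y" unfolding E by auto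
    then show "(THE x. \<exists>u v. e = {u, v} \<and> x = f u v) = c powr (1 / (real (card X) * real (card Y)))"
      using edge_value[of f u v, OF sym] f by simp
  qed simp
  also have "\<dots> = (c powr (1 / (real (card X) * real (card Y)))) powr (real (card X * card Y))"
    using c by (simp add: card powr_realpow del: of_nat_mult)
  also have "\<dots> = c"
    using assms(1,2,4,5) c by (simp add: powr_powr)
  finally show ?thesis .
qed

lemma num_indep_eq_edge_prod:
  assumes G: "pair_graph G" and union: "disjoint_union_complete_bipartite G"
  shows "real (num_indep G) = edge_prod G (\<lambda>u v. (2 ^ vdegree G u + 2 ^ vdegree G v - 1)
          powr (1 / (real (vdegree G u) * real (vdegree G v))))" (is "_ = edge_prod G ?f")
proof -
  obtain \<H> where \<H>: "disjoint_union_of \<H> G"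
    and bip: "\<And>H. H \<in> \<H> \<Longrightarrow> \<exists>a\<ge>1. \<exists>b\<ge>1. complete_bipartite_digraph a b (with_proj H)"
    using union unfolding disjoint_union_complete_bipartite_def by blast
  have V: "pverts G = (\<Union>H\<in>\<H>. pverts H)" and E: "parcs G = (\<Union>H\<in>\<H>. parcs H)"
    and disj: "\<And>H H'. H \<in> \<H> \<Longrightarrow> H' \<in> \<H> \<Longrightarrow> H \<noteq> H' \<Longrightarrow> pverts H \<inter> pverts H' = {}"
    using \<H> by (auto simp: disjoint_union_of_def disjoint_family_on_def)
  have parts: "\<exists>X Y. finite X \<and> finite Y \<and> X \<inter> Y = {} \<and> X \<noteq> {} \<and> Y \<noteq> {} \<and>
      pverts H = X \<union> Y \<and> parcs H = X \<times> Y \<union> Y \<times> X" if H: "H \<in> \<H>" for H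
  proof -
    obtain a b where ab: "a \<ge> 1" "b \<ge> 1" and "complete_bipartite_digraph a b (with_proj H)"
      using bip[OF H] by blast
    then obtain X Y where "finite (pverts H)" "pverts H = X \<union> Y" "X \<inter> Y = {}" "card X = a" "card Y = b"
      "parcs H = X \<times> Y \<union> Y \<times> X" unfolding complete_bipartite_digraph_pair_def by blast
    moreover from this ab have "X \<noteq> {}" "Y \<noteq> {}" by auto
    ultimately show ?thesis by (intro exI[of _ X] exI[of _ Y]) auto
  qed
  have graphs: "pair_graph H" if "H \<in> \<H>" for H
    using bip[OF that] pair_graphI_complete_bipartite by blast
  have "inj_on pverts \<H>"
  proof (rule inj_onI, rule ccontr)
    fix H H' assume "H \<in> \<H>" "H' \<in> \<H>" "pverts H = pverts H'" "H \<noteq> H'"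
    then show False using disj[of H H'] parts[of H] by auto
  qed
  moreover have "finite (pverts ` \<H>)"
    using pair_graph_simps(4)[OF G] by (rule finite_subset[rotated, OF finite_Pow_iff[THEN iffD2]]) (auto simp: V)
  ultimately have fin: "finite \<H>" by (simp add: finite_image_iff)
  have component: "edge_prod H ?f = real (num_indep H)" if H: "H \<in> \<H>" for H
  proof -
    obtain X Y where XY: "finite X" "finite Y" "X \<inter> Y = {}" "X \<noteq> {}" "Y \<noteq> {}"
      and pH: "pverts H = X \<union> Y" and aH: "parcs H = X \<times> Y \<union> Y \<times> X"
      using parts[OF H] by blast
    have nb: "nbhd G u = nbhd H u" if "u \<in> pverts H" for u
    proof -
      have "H' = H" if "H' \<in> \<H>" "(u, v) \<in> parcs H'" for H' v
        using disj[OF that(1) H] pair_graph_simps(3)[OF graphs[OF that(1)]] that \<open>u \<in> pverts H\<close> by blast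
      then show ?thesis using H unfolding E by blast
    qed
    have dX: "vdegree G u = card Y" if "u \<in> X" for u
    proof -
      have "nbhd H u = Y" using that XY(3) by (auto simp: aH)
      then show ?thesis using nb[of u] that by (simp add: vdegree_eq_card_nbhd pH)
    qed
    have dY: "vdegree G v = card X" if "v \<in> Y" for v
    proof -
      have "nbhd H v = X" using that XY(3) by (auto simp: aH)
      then show ?thesis using nb[of v] that by (simp add: vdegree_eq_card_nbhd pH)
    qed
    have "(1::real) \<le> 2 ^ card X" "(1::real) \<le> 2 ^ card Y" by simp_all
    then have pos: "(2 ^ card X + 2 ^ card Y - 1 :: real) > 0" by linarith
    have "edge_prod H ?f = 2 ^ card X + 2 ^ card Y - 1"
      by (rule edge_prod_bipartition[OF XY aH _ _ pos]) (simp_all add: dX dY add.commute mult.commute)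
    then show ?thesis using num_indep_bipartition[OF XY(1-3) pH aH] by simp
  qed
  have "num_indep G = (\<Prod>H\<in>\<H>. num_indep H)"
    by (rule num_indep_disjoint_union[OF fin \<H> _ G]) (rule graphs)
  moreover have "edge_prod G ?f = (\<Prod>H\<in>\<H>. edge_prod H ?f)"
    by (rule edge_prod_disjoint_union[OF fin \<H>]) (rule graphs)
  ultimately show ?thesis by (simp add: component)
qed

section \<open>The bound for arbitrary graphs\<close>

theorem theorem1p2:
  fixes G :: "'a pair_pre_digraph"
  assumes "pair_graph G"
    and "\<And>v. v \<in> pverts G \<Longrightarrow> vdegree G v \<noteq> 0"
  shows "real (num_indep G) \<le>
        edge_prod G (\<lambda>u v. real (num_indep (complete_bipartite (vdegree G u) (vdegree G v)))
          powr (1 / (real (vdegree G u) * real (vdegree G v)))) \<and>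
      edge_prod G (\<lambda>u v. real (num_indep (complete_bipartite (vdegree G u) (vdegree G v)))
          powr (1 / (real (vdegree G u) * real (vdegree G v)))) =
        edge_prod G (\<lambda>u v. (2 ^ vdegree G u + 2 ^ vdegree G v - 1)
          powr (1 / (real (vdegree G u) * real (vdegree G v)))) \<and>
      (real (num_indep G) =
        edge_prod G (\<lambda>u v. real (num_indep (complete_bipartite (vdegree G u) (vdegree G v)))
          powr (1 / (real (vdegree G u) * real (vdegree G v)))) \<longleftrightarrow>
        disjoint_union_complete_bipartite G)"
proof -
  note G' = pair_graph_simps[OF assms(1)]
  define f where "f u v = (2 ^ vdegree G u + 2 ^ vdegree G v - 1 :: real)
    powr (1 / (real (vdegree G u) * real (vdegree G v)))" for u v
  define P where "P = {(S, T). S \<subseteq> pverts G \<and> T \<subseteq> pverts G \<and> S \<times> T \<inter> parcs G = {}}"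
  have conv: "(parcs G)\<inverse> = parcs G" using G'(1) by (simp add: sym_conv_converse_eq)
  have no_isolated: "nbhd G v \<noteq> {}" if "v \<in> pverts G" for v
    using assms(2)[OF that] by (auto simp: vdegree_eq_card_nbhd)
  interpret dc: bipartite "pverts G" "pverts G" "parcs G"
    using G' no_isolated by unfold_locales auto
  have pairs: "dc.indep_pairs = P" by (simp add: dc.indep_pairs_def P_def)
  have f_sym: "f u v = f v u" for u v by (simp add: f_def add.commute mult.commute)
  have sq: "(\<Prod>(u, v)\<in>parcs G. (2 ^ card (nbhd G u) + 2 ^ card ((parcs G)\<inverse> `` {v}) - 1)
      powr (1 / (real (card (nbhd G u)) * real (card ((parcs G)\<inverse> `` {v}))))) = edge_prod G f ^ 2"
    unfolding edge_prod_square[OF assms(1) f_sym] f_def conv vdegree_eq_card_nbhd ..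
  have M: "(parcs G)\<inverse> `` {v} \<noteq> {}" if "v \<in> pverts G" for v
    using no_isolated[OF that] by (simp add: conv)
  have card_P: "real (card P) \<le> edge_prod G f ^ 2"
    using dc.card_indep_pairs(1)[OF M] unfolding pairs sq by simp
  \<comment> \<open>Equality in the theorem forces equality both here and in the bound for the double cover.\<close>
  have square: "real (num_indep G) ^ 2 \<le> real (card P)"
    using num_indep_square_le[OF assms(1)] unfolding P_def of_nat_power[symmetric] of_nat_le_iff .
  have nonneg: "edge_prod G f \<ge> 0"
    unfolding edge_prod_def
  proof (rule prod_nonneg)
    fix e assume "e \<in> edges G"
    then obtain u v where "e = {u, v}" by (auto simp: edges_def)
    then show "0 \<le> (THE x. \<exists>u v. e = {u, v} \<and> x = f u v)"
      using edge_value[of f u v, OF f_sym] by (simp add: f_def)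
  qed
  have le: "real (num_indep G) \<le> edge_prod G f"
    using power2_le_imp_le[OF order_trans[OF square card_P] nonneg] .
  have eq_iff: "real (num_indep G) = edge_prod G f \<longleftrightarrow> disjoint_union_complete_bipartite G"
  proof
    assume "real (num_indep G) = edge_prod G f"
    then have "real (card P) = edge_prod G f ^ 2" using square card_P by simp
    then have twins: "nbhd G u = nbhd G u'" if "u \<in> pverts G" "u' \<in> pverts G" "nbhd G u \<inter> nbhd G u' \<noteq> {}" for u u'
      using dc.card_indep_pairs(2)[OF M _ that] unfolding pairs sq by simp
    show "disjoint_union_complete_bipartite G"
    proof (rule disjoint_union_complete_bipartiteI[OF assms(1) no_isolated])
      fix u u' assume "nbhd G u \<inter> nbhd G u' \<noteq> {}"
      then show "nbhd G u = nbhd G u'" using G'(3) by (intro twins) auto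
    qed
  next
    assume "disjoint_union_complete_bipartite G"
    then show "real (num_indep G) = edge_prod G f"
      unfolding f_def by (rule num_indep_eq_edge_prod[OF assms(1)])
  qed
  show ?thesis
    unfolding num_indep_complete_bipartite using le eq_iff unfolding f_def by blast
qed

end
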